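(* Let $n,m\in\mathbb{N}$. Consider the following three cases: (i) the Leaky-ReLU case, where the networks are from $\mathcal{NN}_{\mathrm{LReLU}}(n,m,w)$ with $w=\max(2n+1,m)$; (ii) $\sigma=\mathrm{ReLU}$, with networks from $\mathcal{NN}_{\sigma}(n,m,w)$ with $w=\max(2n+1,m)+1$; (iii) $\sigma:\mathbb{R}\to\mathbb{R}$ any continuous nonpolynomial function which is continuously differentiable on a neighbourhood of some point $a\in\mathbb{R}$ with $\sigma'(a)\neq 0$, with networks from $\mathcal{NN}_{\sigma}(n,m,w)$ with $w=\max(2n+1,m)+2$. In each case, the corresponding network class compactly approximates $C(\mathbb{R}^n,\mathbb{R}^m)$: for every continuous $f:\mathbb{R}^n\to\mathbb{R}^m$, every compact $K\subset\mathbb{R}^n$ and every $\epsilon>0$ there is a network $g$ in the class with $\sup_{x\in K}\|f(x)-g(x)\|_\infty<\epsilon$.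
   Context: For $\beta\in\mathbb{R}$, $\mathrm{LReLU}_\beta(x)=x$ if $x\ge 0$ and $\beta x$ if $x<0$; $\mathrm{ReLU}(x)=\max(x,0)$. Activations act componentwise on vectors. For an activation $\sigma$ and $d_x,d_y,w\in\mathbb{N}$, $\mathcal{NN}_\sigma(d_x,d_y,w)$ is the set of all maps $W_{N+1}\circ\sigma\circ W_N\circ\sigma\circ\cdots\circ\sigma\circ W_1:\mathbb{R}^{d_x}\to\mathbb{R}^{d_y}$ with $N\in\mathbb{N}_0$, integers $1\le d_1,\dots,d_N\le w$, $d_0=d_x$, $d_{N+1}=d_y$, and $W_i:\mathbb{R}^{d_{i-1}}\to\mathbb{R}^{d_i}$ affine. $\mathcal{NN}_{\mathrm{LReLU}}(d_x,d_y,w)$ is defined the same way, except that the $i$-th activation layer is $\mathrm{LReLU}_{\beta_i}$ with a slope $\beta_i\in\mathbb{R}$ that may be chosen independently for each layer. *)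

theory Defs
  imports "HOL-Analysis.Analysis" "HOL-Computational_Algebra.Polynomial"
begin

definition lrelu :: "real \<Rightarrow> real \<Rightarrow> real" where
  "lrelu \<beta> x = (if x \<ge> 0 then x else \<beta> * x)"

definition relu :: "real \<Rightarrow> real" where
  "relu x = max x 0"

text \<open>Hidden part of a network: \<open>hid S w d h\<close> means
  h = act_k o W_k o ... o act_1 o W_1 with k >= 1, each hidden width d_i in [1, w],
  each activation act_i taken from the set S of admissible activations, and last
  hidden width d. The input lives in real^'n (so d_0 = CARD('n)); hidden vectors
  are represented as functions nat => real of which only the first d entries matter.\<close>
inductive hid :: "(real \<Rightarrow> real) set \<Rightarrow> nat \<Rightarrow> nat \<Rightarrow> (real ^ 'n \<Rightarrow> (nat \<Rightarrow> real)) \<Rightarrow> bool"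
  for S :: "(real \<Rightarrow> real) set" and w :: nat where
  first: "\<lbrakk>1 \<le> d; d \<le> w; \<rho> \<in> S\<rbrakk> \<Longrightarrow>
     hid S w d (\<lambda>x i. \<rho> ((\<Sum>j\<in>UNIV. A i j * x $ j) + c i))"
| step: "\<lbrakk>hid S w d h; 1 \<le> d'; d' \<le> w; \<rho> \<in> S\<rbrakk> \<Longrightarrow>
     hid S w d' (\<lambda>x i. \<rho> ((\<Sum>j<d. B i j * h x j) + c i))"

definition NN :: "(real \<Rightarrow> real) set \<Rightarrow> nat \<Rightarrow> (real ^ 'n \<Rightarrow> real ^ 'm) set" where
  "NN S w =
     {g. \<exists>A c. g = (\<lambda>x. \<chi> k. (\<Sum>j\<in>UNIV. A k j * x $ j) + c k)}
   \<union> {g. \<exists>d h B c. hid S w d h \<and> g = (\<lambda>x. \<chi> k. (\<Sum>j<d. B k j * h x j) + c k)}"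

text \<open>Compact approximation of C(R^n, R^m) w.r.t. the sup of the max-norm over K.
  "sup < eps" is written as: there is delta < eps bounding the error on K.\<close>
definition compactly_approximates :: "(real ^ 'n \<Rightarrow> real ^ 'm) set \<Rightarrow> bool" where
  "compactly_approximates G \<longleftrightarrow>
     (\<forall>f. continuous_on UNIV f \<longrightarrow> (\<forall>K. compact K \<longrightarrow> (\<forall>\<epsilon>>0.
        (\<exists>g\<in>G. \<exists>\<delta><\<epsilon>. \<forall>x\<in>K. infnorm (f x - g x) \<le> \<delta>))))"

end

theory Submission
  imports Defs
begin

text \<open>
  Let \<open>d\<close> be the larger of \<open>2n+1\<close> and \<open>m\<close>; after padding, the target map goes to \<open>\<real>\<^sup>d\<close>.
  Approximate it by \<open>c + F\<close>, where \<open>F\<close> is a polynomial map with \<open>F 0 = 0\<close>. Since \<open>d > 2n\<close>, a small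
  generic linear perturbation makes \<open>F\<close> an injective immersion: the bad coefficients form the smooth
  image of a \<open>2n\<close>-dimensional space. Then \<open>G t x = F (t x) / t\<close> joins the linear map \<open>DF(0)\<close> to \<open>F\<close>
  through embeddings that are bi-Lipschitz uniformly in \<open>t\<close>, so \<open>G\<close> is carried along by a
  time-dependent vector field on \<open>\<real>\<^sup>d\<close> that is uniformly Lipschitz in space.

  This flow is followed by an Euler scheme whose steps are compositions of shears
  \<open>z \<mapsto> z + \<sigma>(a \<bullet> z + b) v\<close>. The fields \<open>V\<close> for which \<open>id + h V\<close> is reached up to \<open>o(h)\<close> are closed under
  sums and locally uniform limits; they contain \<open>\<sigma>(a \<bullet> z + b) v\<close>, and hence, as \<open>\<sigma>\<close> is continuous and
  not a polynomial, all continuous fields. One hidden layer realises a shear approximately: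
  with one extra neuron when \<open>\<sigma>\<close> has a point of nonzero derivative, and with no extra neuron for
  Leaky-ReLU, where \<open>z + ReLU(a \<bullet> z + b) v\<close> is linearly conjugate to a one-coordinate
  Leaky-ReLU map as soon as \<open>a \<bullet> v\<close> avoids \<open>0\<close> and \<open>-1\<close>.
\<close>


subsection \<open>Monomials from a continuous nonpolynomial function\<close>

definition fdiff :: "real \<Rightarrow> (real \<Rightarrow> real) \<Rightarrow> real \<Rightarrow> real" where
  "fdiff h g x = g (x + h) - g x"

text \<open>Newton's forward-difference formula. The induction hypothesis describes the increments
  along the lattice, and summing them back turns \<open>n choose j\<close> into
  \<open>n choose Suc j\<close> by Pascal's rule.\<close>

lemma newton_lattice:
  assumes "\<And>x. (fdiff h ^^ k) g x = 0"
  shows "\<exists>c. \<forall>n::nat. g (x0 + real n * h) = (\<Sum>j<k. c j * real (n choose j))"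
  using assms
proof (induction k arbitrary: g)
  case 0
  then show ?case by simp
next
  case (Suc k)
  have "\<And>x. (fdiff h ^^ k) (fdiff h g) x = 0"
    using Suc.prems by (simp add: funpow_swap1)
  then obtain c where c: "\<And>n::nat. fdiff h g (x0 + real n * h) = (\<Sum>j<k. c j * real (n choose j))"
    using Suc.IH by blast
  define c' where "c' j = (case j of 0 \<Rightarrow> g x0 | Suc i \<Rightarrow> c i)" for j
  have c': "(\<Sum>j<Suc k. c' j * real (m choose j)) = g x0 + (\<Sum>j<k. c j * real (m choose Suc j))" for m
    by (subst sum.lessThan_Suc_shift) (simp add: c'_def)
  have "g (x0 + real n * h) = (\<Sum>j<Suc k. c' j * real (n choose j))" for n
    unfolding c'
  proof (induction n)
    case 0
    then show ?case by simp
  next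
    case (Suc n)
    have "g (x0 + real (Suc n) * h) = g (x0 + real n * h) + fdiff h g (x0 + real n * h)"
      by (simp add: fdiff_def algebra_simps)
    also have "\<dots> = g x0 + (\<Sum>j<k. c j * real (Suc n choose Suc j))"
      by (simp add: Suc.IH c distrib_left sum.distrib)
    finally show ?case .
  qed
  then show ?case by blast
qed

text \<open>Binomial coefficients are polynomials in the upper index, and the lattice index is an
  affine function of the lattice point.\<close>

lemma fdiff_eq_0_lattice_poly:
  assumes "\<And>x. (fdiff h ^^ k) g x = 0" and "h > 0"
  shows "\<exists>p. \<forall>n::nat. g (x0 + real n * h) = poly p (x0 + real n * h)"
proof -
  obtain c where c: "\<And>n::nat. g (x0 + real n * h) = (\<Sum>j<k. c j * real (n choose j))"
    using newton_lattice[OF assms(1), of x0] by blast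
  define q where "q = (\<Sum>j<k. smult (c j / fact j) (\<Prod>i=0..<j. [:- real i, 1:]))"
  have "poly q (real n) = (\<Sum>j<k. c j * real (n choose j))" for n
    by (simp add: q_def poly_sum poly_prod binomial_gbinomial gbinomial_prod_rev)
  moreover have "poly (pcompose q [:- x0 / h, 1 / h:]) (x0 + real n * h) = poly q (real n)" for n
    using \<open>h > 0\<close> by (simp add: poly_pcompose field_simps)
  ultimately show ?thesis using c by metis
qed

text \<open>The interpolating polynomials of two lattices containing the natural numbers agree there, hence
  are equal; so one polynomial works on all of \<open>\<rat>\<close>.\<close>

lemma frechet_polynomial:
  fixes g :: "real \<Rightarrow> real"
  assumes cont: "continuous_on UNIV g" and diff: "\<And>h x. h > 0 \<Longrightarrow> (fdiff h ^^ k) g x = 0"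
  shows "\<exists>p. \<forall>x. g x = poly p x"
proof -
  obtain p where "\<And>n::nat. g (0 + real n * 1) = poly p (0 + real n * 1)"
    using fdiff_eq_0_lattice_poly[OF diff, of 1 0] by (metis zero_less_one)
  then have p: "\<And>n::nat. g (real n) = poly p (real n)" by simp
  have rat: "g r = poly p r" if r: "r \<in> \<rat>" for r
  proof -
    obtain a :: int and b :: nat where ab: "r = real_of_int a / real b" "b \<noteq> 0"
      using r unfolding Rats_eq_int_div_nat by blast
    \<comment> \<open>With start \<open>- m\<close> and step \<open>1 / b\<close>, the natural
      number \<open>j\<close> is lattice point number \<open>(j + m) * b\<close>, and
      \<open>r = a / b\<close> is number \<open>a + m * b\<close>, which is nonnegative by the
      choice of \<open>m\<close>.\<close>
    define m where "m = nat \<bar>a\<bar>"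
    obtain q where q: "\<And>n::nat. g (- real m + real n * (1 / real b)) = poly q (- real m + real n * (1 / real b))"
      using fdiff_eq_0_lattice_poly[OF diff, of "1 / real b" "- real m"] ab by auto
    have "poly q (real j) = poly p (real j)" for j
    proof -
      have "- real m + real ((j + m) * b) * (1 / real b) = real j"
        using ab by simp
      then show ?thesis using q[of "(j + m) * b"] p[of j] by metis
    qed
    then have "range real \<subseteq> {x. poly (q - p) x = 0}" by auto
    moreover have "infinite (range real)"
      using finite_imageD[of real UNIV] by (auto simp: inj_on_def)
    ultimately have "q = p"
      using poly_roots_finite[of "q - p"] finite_subset by auto
    have "a + int m * int b \<ge> 0"
    proof -
      have "- a \<le> int m" unfolding m_def by simp
      also have "int m * 1 \<le> int m * int b" using ab by (intro mult_left_mono) auto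
      finally show ?thesis by simp
    qed
    then have "real (nat (a + int m * int b)) = real_of_int a + real m * real b" by simp
    then have "- real m + real (nat (a + int m * int b)) * (1 / real b) = r"
      using ab by (simp add: field_simps)
    then show ?thesis using q[of "nat (a + int m * int b)"] \<open>q = p\<close> by simp
  qed
  have "g x = poly p x" for x
  proof -
    have "closed {x. g x = poly p x}"
      by (intro closed_Collect_eq cont continuous_intros)
    moreover have "\<rat> \<subseteq> {x. g x = poly p x}" using rat by blast
    ultimately have "closure \<rat> \<subseteq> {x. g x = poly p x}" by (simp add: closure_minimal)
    then show ?thesis using Rats_closure_real by auto
  qed
  then show ?thesis by blast
qed

lemma real_antiderivative:
  fixes g :: "real \<Rightarrow> real"
  assumes "continuous_on UNIV g"
  obtains S where "\<And>x. (S has_real_derivative g x) (at x)"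
proof -
  have "\<exists>F. \<forall>x::real. -\<infinity> < ereal x \<longrightarrow> ereal x < \<infinity> \<longrightarrow> (F has_vector_derivative g x) (at x)"
    by (rule einterval_antiderivative) (use assms in \<open>auto simp: continuous_on_eq_continuous_at\<close>)
  then show ?thesis
    using that by (auto simp: has_real_derivative_iff_has_vector_derivative)
qed

lemma fdiff_has_derivative:
  assumes "\<And>x. (F has_real_derivative f x) (at x)"
  shows "((fdiff h ^^ k) F has_real_derivative (fdiff h ^^ k) f x) (at x)"
proof (induction k arbitrary: x)
  case 0
  then show ?case using assms by simp
next
  case (Suc k)
  have "((\<lambda>x. (fdiff h ^^ k) F (x + h)) has_real_derivative (fdiff h ^^ k) f (x + h)) (at x)"
    using Suc[of "x + h"] by (simp add: DERIV_shift)
  then have "((\<lambda>x. (fdiff h ^^ k) F (x + h) - (fdiff h ^^ k) F x) has_real_derivative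
      (fdiff h ^^ k) f (x + h) - (fdiff h ^^ k) f x) (at x)"
    by (rule DERIV_diff) (rule Suc)
  then show ?case by (simp add: fdiff_def[abs_def])
qed

lemma continuous_on_fdiff:
  assumes "continuous_on UNIV g"
  shows "continuous_on UNIV ((fdiff h ^^ k) g)"
proof (induction k)
  case 0
  then show ?case using assms by simp
next
  case (Suc k)
  have "continuous_on UNIV (\<lambda>x. (fdiff h ^^ k) g (x + h))"
    by (rule continuous_on_compose2[OF Suc]) (auto intro!: continuous_intros)
  then show ?case using Suc by (auto simp: fdiff_def[abs_def] intro!: continuous_intros)
qed

lemma uniform_delta_interval:
  fixes g :: "real \<Rightarrow> real"
  assumes "continuous_on UNIV g" "e > 0"
  obtains d where "d > 0" "\<And>x y. \<bar>x\<bar> \<le> R \<Longrightarrow> \<bar>y\<bar> \<le> R \<Longrightarrow> \<bar>x - y\<bar> < d \<Longrightarrow> \<bar>g x - g y\<bar> < e"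
proof -
  have "uniformly_continuous_on {-R..R} g"
    using assms by (intro compact_uniformly_continuous) (auto intro: continuous_on_subset)
  then have "\<exists>d>0. \<forall>x\<in>{-R..R}. \<forall>y\<in>{-R..R}. dist y x < d \<longrightarrow> dist (g y) (g x) < e"
    unfolding uniformly_continuous_on_def using \<open>e > 0\<close> by simp
  then obtain d where d: "d > 0" "\<forall>x\<in>{-R..R}. \<forall>y\<in>{-R..R}. dist y x < d \<longrightarrow> dist (g y) (g x) < e"
    by blast
  show ?thesis
  proof (rule that[OF d(1)])
    fix x y :: real
    assume "\<bar>x\<bar> \<le> R" "\<bar>y\<bar> \<le> R" "\<bar>x - y\<bar> < d"
    then show "\<bar>g x - g y\<bar> < e"
      using d(2)[rule_format, of y x] by (simp add: dist_real_def abs_le_iff)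
  qed
qed

section \<open>Closed affine-invariant function spaces on the line\<close>

text \<open>The intended instance consists of the profiles all of whose ridge fields lie in
  \<open>euler_fields A\<close>; \<open>lim\<close> is closedness under locally uniform
  limits.\<close>

locale affine_invariant_space =
  fixes M :: "(real \<Rightarrow> real) set"
  assumes cont: "f \<in> M \<Longrightarrow> continuous_on UNIV f"
    and zero: "(\<lambda>t. 0) \<in> M"
    and add: "f \<in> M \<Longrightarrow> g \<in> M \<Longrightarrow> (\<lambda>t. f t + g t) \<in> M"
    and scale: "f \<in> M \<Longrightarrow> (\<lambda>t. c * f t) \<in> M"
    and subst: "f \<in> M \<Longrightarrow> (\<lambda>t. f (l * t + b)) \<in> M"
    and lim: "continuous_on UNIV f \<Longrightarrow>
      (\<And>R e. e > 0 \<Longrightarrow> \<exists>g\<in>M. \<forall>t. \<bar>t\<bar> \<le> R \<longrightarrow> \<bar>f t - g t\<bar> \<le> e) \<Longrightarrow> f \<in> M"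
begin

lemma sum: "finite I \<Longrightarrow> (\<And>i. i \<in> I \<Longrightarrow> f i \<in> M) \<Longrightarrow> (\<lambda>t. \<Sum>i\<in>I. f i t) \<in> M"
  by (induction rule: finite_induct) (auto intro: zero add)

text \<open>\<open>fdiff h S x\<close> is the integral of \<open>g\<close> over
  \<open>[x, x + h]\<close>. Its Riemann sums combine translates of \<open>g\<close>, and uniform
  continuity of \<open>g\<close> on bounded intervals makes them converge locally uniformly.\<close>

lemma increment_mem:
  assumes g: "g \<in> M" and S: "\<And>x. (S has_real_derivative g x) (at x)" and h: "h > 0"
  shows "fdiff h S \<in> M"
proof (rule lim)
  have "continuous_on UNIV S"
    using S by (meson DERIV_isCont continuous_at_imp_continuous_on)
  then show "continuous_on UNIV (fdiff h S)"
    using continuous_on_fdiff[of S 1 h] by simp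
next
  fix R e :: real
  assume "e > 0"
  \<comment> \<open>The tolerance is \<open>e / h\<close> because the \<open>n\<close> cells of
    length \<open>h / n\<close> then contribute at most \<open>e\<close> in total; all sample points
    stay within radius \<open>\<bar>R\<bar> + h\<close>.\<close>
  obtain d where d: "d > 0" "\<And>x y. \<bar>x\<bar> \<le> \<bar>R\<bar> + h \<Longrightarrow> \<bar>y\<bar> \<le> \<bar>R\<bar> + h \<Longrightarrow> \<bar>x - y\<bar> < d \<Longrightarrow> \<bar>g x - g y\<bar> < e / h"
    using uniform_delta_interval[OF cont[OF g], of "e / h"] \<open>e > 0\<close> h by auto
  obtain n :: nat where n: "h / d < real n" using reals_Archimedean2 by blast
  then have "n > 0" using h d(1) by (cases n) (auto simp: divide_less_0_iff)
  have small: "h / real n < d" using n d(1) \<open>n > 0\<close> by (simp add: field_simps)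
  define a where "a x i = x + real i * (h / real n)" for x i
  have close: "\<bar>fdiff h S x - (\<Sum>i<n. (h / real n) * g (a x i))\<bar> \<le> e" if x: "\<bar>x\<bar> \<le> R" for x
  proof -
    have "fdiff h S x = S (a x n) - S (a x 0)"
      using \<open>n > 0\<close> by (simp add: fdiff_def a_def)
    also have "\<dots> = (\<Sum>i<n. S (a x (Suc i)) - S (a x i))"
      by (rule sum_lessThan_telescope[of "\<lambda>i. S (a x i)", symmetric])
    finally have "fdiff h S x - (\<Sum>i<n. (h / real n) * g (a x i))
        = (\<Sum>i<n. S (a x (Suc i)) - S (a x i) - (h / real n) * g (a x i))"
      by (simp add: sum_subtractf)
    also have "\<bar>\<dots>\<bar> \<le> (\<Sum>i<n. e / real n)"
    proof (rule order_trans[OF sum_abs], rule sum_mono)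
      fix i assume "i \<in> {..<n}"
      then have i: "i < n" by simp
      have "a x i < a x (Suc i)" using h \<open>n > 0\<close> by (simp add: a_def field_simps)
      then obtain z where z: "a x i < z" "z < a x (Suc i)"
        "S (a x (Suc i)) - S (a x i) = (a x (Suc i) - a x i) * g z"
        using MVT2[of "a x i" "a x (Suc i)" S g] S by blast
      have step: "a x (Suc i) - a x i = h / real n" by (simp add: a_def algebra_simps add_divide_distrib)
      have "real (Suc i) * (h / real n) \<le> real n * (h / real n)"
        using i h by (intro mult_right_mono) auto
      then have up: "a x (Suc i) \<le> x + h" using \<open>n > 0\<close> by (simp add: a_def)
      have lo: "x \<le> a x i" using h by (simp add: a_def)
      have "\<bar>g z - g (a x i)\<bar> < e / h"
        using x z(1,2) up lo step small by (intro d(2)) auto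
      then have "\<bar>(h / real n) * (g z - g (a x i))\<bar> \<le> (h / real n) * (e / h)"
        using h unfolding abs_mult by (intro mult_mono) auto
      then show "\<bar>S (a x (Suc i)) - S (a x i) - (h / real n) * g (a x i)\<bar> \<le> e / real n"
        using z(3) step h by (simp add: right_diff_distrib)
    qed
    also have "\<dots> = e" using \<open>n > 0\<close> by simp
    finally show ?thesis .
  qed
  have mem: "(\<lambda>x. \<Sum>i<n. (h / real n) * g (a x i)) \<in> M"
  proof (rule sum)
    fix i
    show "(\<lambda>x. (h / real n) * g (a x i)) \<in> M"
      using scale[OF subst[OF g, of 1 "real i * (h / real n)"], of "h / real n"] by (simp add: a_def)
  qed simp
  show "\<exists>f\<in>M. \<forall>t. \<bar>t\<bar> \<le> R \<longrightarrow> \<bar>fdiff h S t - f t\<bar> \<le> e"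
    using close by (intro bexI[OF _ mem] allI impI)
qed

text \<open>Differentiating \<open>t ^ k * G (l * t + b)\<close> in the slope \<open>l\<close>
  brings out the factor \<open>t\<close>. The difference quotients in \<open>l\<close> lie in
  \<open>M\<close> and converge locally uniformly, since \<open>G'\<close> is uniformly continuous
  on bounded intervals.\<close>

lemma dilation_derivative_mem:
  assumes G: "\<And>x. (G has_real_derivative G' x) (at x)" and G': "continuous_on UNIV G'"
    and mem: "\<And>l b. (\<lambda>t. t ^ k * G (l * t + b)) \<in> M"
  shows "(\<lambda>t. t ^ Suc k * G' (l * t + b)) \<in> M"
proof (rule lim)
  show "continuous_on UNIV (\<lambda>t. t ^ Suc k * G' (l * t + b))"
    by (intro continuous_intros continuous_on_compose2[OF G']) auto
next
  fix R e :: real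
  assume "e > 0"
  define r where "r = max 1 R"
  have r: "r \<ge> 1" "R \<le> r" by (auto simp: r_def)
  \<comment> \<open>\<open>B\<close> bounds \<open>l * t + b\<close> and every point between it and
    \<open>(l + s) * t + b\<close>, for \<open>\<bar>t\<bar> \<le> r\<close> and
    \<open>0 < s \<le> 1\<close>.\<close>
  define B where "B = (\<bar>l\<bar> + 1) * r + \<bar>b\<bar>"
  obtain d where d: "d > 0" "\<And>x y. \<bar>x\<bar> \<le> B \<Longrightarrow> \<bar>y\<bar> \<le> B \<Longrightarrow> \<bar>x - y\<bar> < d \<Longrightarrow> \<bar>G' x - G' y\<bar> < e / r ^ Suc k"
    using uniform_delta_interval[OF G', of "e / r ^ Suc k" B] \<open>e > 0\<close> r by auto
  define s where "s = min 1 (d / (2 * r))"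
  have s: "s > 0" "s \<le> 1" "s * r < d"
    using d r by (auto simp: s_def min_def field_simps)
  let ?f = "\<lambda>t. (1 / s) * (t ^ k * G ((l + s) * t + b)) + (- 1 / s) * (t ^ k * G (l * t + b))"
  have mem_f: "?f \<in> M" by (intro add scale mem)
  have close: "\<bar>t ^ Suc k * G' (l * t + b) - ?f t\<bar> \<le> e" if t: "\<bar>t\<bar> \<le> R" for t
  proof -
    have tr: "\<bar>t\<bar> \<le> r" using t r by simp
    define y where "y = l * t + b"
    \<comment> \<open>The increment \<open>s * t\<close> may have either sign, so the intermediate
      point is recorded only through its distance from \<open>y\<close>.\<close>
    have mvt: "\<exists>z. \<bar>z - y\<bar> \<le> \<bar>s * t\<bar> \<and> G (y + s * t) - G y = s * t * G' z"
    proof -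
      consider "s * t = 0" | "s * t > 0" | "s * t < 0" by linarith
      then show ?thesis
      proof cases
        case 1
        then show ?thesis by auto
      next
        case 2
        then obtain z where "y < z" "z < y + s * t" "G (y + s * t) - G y = (y + s * t - y) * G' z"
          using MVT2[of y "y + s * t" G G'] G by auto
        then show ?thesis by (intro exI[of _ z]) auto
      next
        case 3
        then obtain z where "y + s * t < z" "z < y" "G y - G (y + s * t) = (y - (y + s * t)) * G' z"
          using MVT2[of "y + s * t" y G G'] G by auto
        then show ?thesis by (intro exI[of _ z]) (auto simp: algebra_simps)
      qed
    qed
    then obtain z where z: "\<bar>z - y\<bar> \<le> \<bar>s * t\<bar>" "G (y + s * t) - G y = s * t * G' z" by blast
    have "?f t = t ^ k * (G (y + s * t) - G y) / s"
      by (simp add: y_def algebra_simps diff_divide_distrib)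
    also have "\<dots> = t ^ Suc k * G' z" using z(2) s by simp
    finally have eq: "t ^ Suc k * G' (l * t + b) - ?f t = t ^ Suc k * (G' y - G' z)"
      by (simp add: y_def algebra_simps)
    have st: "\<bar>s * t\<bar> \<le> s * r" using tr s by (simp add: abs_mult)
    have lt: "\<bar>l * t\<bar> \<le> \<bar>l\<bar> * r" using tr by (simp add: abs_mult mult_left_mono)
    have sr: "s * r \<le> r" using s r by simp
    have "\<bar>y\<bar> \<le> B" using lt r by (simp add: y_def B_def algebra_simps)
    moreover have "\<bar>z\<bar> \<le> B" using z(1) lt st sr by (simp add: y_def B_def algebra_simps)
    moreover have "\<bar>y - z\<bar> < d" using z(1) st s by linarith
    ultimately have "\<bar>G' y - G' z\<bar> \<le> e / r ^ Suc k" using d(2) by (simp add: less_imp_le)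
    moreover have "\<bar>t\<bar> ^ Suc k \<le> r ^ Suc k" using tr by (intro power_mono) auto
    ultimately have "\<bar>t\<bar> ^ Suc k * \<bar>G' y - G' z\<bar> \<le> r ^ Suc k * (e / r ^ Suc k)"
      using r by (intro mult_mono) auto
    then show ?thesis using eq r by (simp add: abs_mult power_abs)
  qed
  show "\<exists>g\<in>M. \<forall>t. \<bar>t\<bar> \<le> R \<longrightarrow> \<bar>t ^ Suc k * G' (l * t + b) - g t\<bar> \<le> e"
    using close by (intro bexI[OF _ mem_f] allI impI)
qed

text \<open>The induction applies the hypothesis to the moving average \<open>fdiff h S\<close>, \<open>S' = g\<close>, which lies in \<open>M\<close>
  and has derivative \<open>fdiff h g\<close>; differentiating in \<open>l\<close> then brings out one more factor \<open>t\<close>.\<close>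

lemma power_fdiff_mem:
  assumes "g \<in> M" "h > 0"
  shows "(\<lambda>t. t ^ k * (fdiff h ^^ k) g (l * t + b)) \<in> M"
  using assms(1)
proof (induction k arbitrary: g l b)
  case 0
  then show ?case using subst by simp
next
  case (Suc k)
  obtain S where S: "\<And>x. (S has_real_derivative g x) (at x)"
    using real_antiderivative[OF cont[OF Suc.prems]] by blast
  have mem: "(\<lambda>t. t ^ k * (fdiff h ^^ Suc k) S (l * t + b)) \<in> M" for l b
    using Suc.IH[OF increment_mem[OF Suc.prems S \<open>h > 0\<close>]] by (simp add: funpow_swap1)
  show ?case
    by (rule dilation_derivative_mem[OF fdiff_has_derivative[OF S]
          continuous_on_fdiff[OF cont[OF Suc.prems]] mem])
qed

text \<open>By \<open>frechet_polynomial\<close>, some \<open>k\<close>-th difference of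
  \<open>\<sigma>\<close> is nonzero at a point \<open>x\<close>. Slope \<open>0\<close> and shift
  \<open>x\<close> freeze the difference factor in \<open>power_fdiff_mem\<close> to this nonzero
  constant.\<close>

lemma power_mem:
  assumes "\<sigma> \<in> M" "\<not> (\<exists>p. \<forall>x. \<sigma> x = poly p x)"
  shows "(\<lambda>t. t ^ k) \<in> M"
proof -
  obtain h x where h: "h > 0" and x: "(fdiff h ^^ k) \<sigma> x \<noteq> 0"
    using frechet_polynomial[OF cont[OF assms(1)], of k] assms(2) by blast
  show ?thesis
    using scale[OF power_fdiff_mem[OF assms(1) h, of k 0 x], of "1 / (fdiff h ^^ k) \<sigma> x"] x
    by simp
qed

end

subsection \<open>Density of ridge functions\<close>

text \<open>Weierstrass M-test with the exponential series of \<open>\<bar>r\<bar>\<close> as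
  majorant. This is the passage from ridge powers to ridge exponentials.\<close>

lemma exp_uniform_approx:
  fixes r e :: real
  assumes "e > 0"
  shows "\<exists>n. \<forall>s. \<bar>s\<bar> \<le> r \<longrightarrow> \<bar>exp s - (\<Sum>i<n. s ^ i / fact i)\<bar> < e"
proof -
  have "uniform_limit {-r..r} (\<lambda>n s. \<Sum>i<n. s ^ i / fact i) (\<lambda>s. suminf (\<lambda>i. s ^ i / fact i)) sequentially"
  proof (rule Weierstrass_m_test)
    show "norm (s ^ i / fact i) \<le> \<bar>r\<bar> ^ i / fact i" if "s \<in> {-r..r}" for i s
      using that by (auto simp: power_abs abs_le_iff intro!: divide_right_mono power_mono)
    show "summable (\<lambda>i. \<bar>r\<bar> ^ i / fact i)"
      using summable_exp[of "\<bar>r\<bar>"] by (simp add: field_simps)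
  qed
  then have "\<forall>\<^sub>F n in sequentially. \<forall>s\<in>{-r..r}.
      dist (\<Sum>i<n. s ^ i / fact i) (suminf (\<lambda>i. s ^ i / fact i)) < e"
    using assms by (rule uniform_limitD)
  then obtain n where n: "\<And>s. s \<in> {-r..r} \<Longrightarrow> dist (\<Sum>i<n. s ^ i / fact i) (suminf (\<lambda>i. s ^ i / fact i)) < e"
    unfolding eventually_sequentially by (meson order_refl)
  have "exp s = suminf (\<lambda>i. s ^ i / fact i)" for s :: real
    by (simp add: exp_def field_simps)
  then have "\<bar>exp s - (\<Sum>i<n. s ^ i / fact i)\<bar> < e" if "\<bar>s\<bar> \<le> r" for s
    using n[of s] that by (simp add: dist_real_def abs_minus_commute abs_le_iff)
  then show ?thesis by blast
qed

text \<open>Exponentials are used because a product of two of them is again one, so their span is a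
  ring to which Stone-Weierstrass applies.\<close>

inductive_set exp_span :: "('a::real_inner \<Rightarrow> real) set" where
  ridge: "(\<lambda>z. c * exp (a \<bullet> z)) \<in> exp_span"
| plus: "f \<in> exp_span \<Longrightarrow> g \<in> exp_span \<Longrightarrow> (\<lambda>z. f z + g z) \<in> exp_span"

lemma exp_span_mult:
  assumes "f \<in> exp_span" "g \<in> exp_span"
  shows "(\<lambda>z. f z * g z) \<in> exp_span"
  using assms(1)
proof induction
  case (ridge c a)
  show ?case using assms(2)
  proof induction
    case (ridge c' a')
    have "(\<lambda>z. c * exp (a \<bullet> z) * (c' * exp (a' \<bullet> z))) = (\<lambda>z. (c * c') * exp ((a + a') \<bullet> z))"
      by (simp add: fun_eq_iff inner_add_left exp_add)
    then show ?case using exp_span.ridge[of "c * c'" "a + a'"] by simp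
  next
    case (plus f g)
    then show ?case by (simp add: distrib_left exp_span.plus)
  qed
next
  case (plus f g)
  then show ?case by (simp add: distrib_right exp_span.plus)
qed

lemma exp_span_continuous: "f \<in> exp_span \<Longrightarrow> continuous_on S f"
  by (induction rule: exp_span.induct) (auto intro!: continuous_intros)

lemma exp_span_dense:
  fixes f :: "'a::real_inner \<Rightarrow> real"
  assumes "compact S" "continuous_on S f" "e > 0"
  shows "\<exists>g\<in>exp_span. \<forall>x\<in>S. \<bar>f x - g x\<bar> < e"
proof -
  interpret function_ring_on "exp_span :: ('a \<Rightarrow> real) set" S
  proof
    fix c :: real
    show "(\<lambda>_::'a. c) \<in> exp_span" using exp_span.ridge[of c 0] by simp
  next
    fix x y :: 'a
    assume "x \<noteq> y"
    \<comment> \<open>The exponential in direction \<open>x - y\<close> separates the two points: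
      its exponents at \<open>x\<close> and \<open>y\<close> differ by
      \<open>(x - y) \<bullet> (x - y)\<close>.\<close>
    then have "(x - y) \<bullet> (x - y) \<noteq> 0" by simp
    then have "exp ((x - y) \<bullet> x) \<noteq> exp ((x - y) \<bullet> y)" by (simp add: inner_diff_right)
    then show "\<exists>f\<in>exp_span. f x \<noteq> f y"
      by (intro bexI[OF _ exp_span.ridge[of 1 "x - y"]]) simp
  qed (auto intro: assms exp_span_continuous exp_span.plus exp_span_mult)
  show ?thesis using Stone_Weierstrass_basic[OF assms(2,3)] .
qed

text \<open>This abstraction serves twice: for \<open>euler_fields A\<close> and for the maps
  approximable by ridge polynomials. The free vector \<open>v\<close> absorbs scalar
  factors.\<close>

locale ridge_closed_space =
  fixes V :: "('a::euclidean_space \<Rightarrow> 'b::euclidean_space) set"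
  assumes add: "f \<in> V \<Longrightarrow> g \<in> V \<Longrightarrow> (\<lambda>z. f z + g z) \<in> V"
    and lim: "continuous_on UNIV f \<Longrightarrow>
      (\<And>R e. e > 0 \<Longrightarrow> \<exists>g\<in>V. \<forall>z. norm z \<le> R \<longrightarrow> norm (f z - g z) \<le> e) \<Longrightarrow> f \<in> V"
    and ridge_power: "(\<lambda>z. (a \<bullet> z) ^ k *\<^sub>R v) \<in> V"
begin

lemma sum: "finite I \<Longrightarrow> (\<And>i. i \<in> I \<Longrightarrow> f i \<in> V) \<Longrightarrow> (\<lambda>z. \<Sum>i\<in>I. f i z) \<in> V"
proof (induction rule: finite_induct)
  case empty
  then show ?case using ridge_power[of 0 0 0] by simp
next
  case (insert x F)
  then show ?case by (auto intro: add)
qed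

lemma ridge_exp: "(\<lambda>z. exp (a \<bullet> z) *\<^sub>R v) \<in> V"
proof (rule lim)
  show "continuous_on UNIV (\<lambda>z. exp (a \<bullet> z) *\<^sub>R v)" by (intro continuous_intros)
next
  fix R e :: real
  assume "e > 0"
  \<comment> \<open>The summand \<open>1\<close> keeps the tolerance meaningful when
    \<open>v = 0\<close>.\<close>
  then have "e / (norm v + 1) > 0" by (simp add: add_nonneg_pos)
  then obtain n where n: "\<And>s. \<bar>s\<bar> \<le> norm a * R \<Longrightarrow> \<bar>exp s - (\<Sum>i<n. s ^ i / fact i)\<bar> < e / (norm v + 1)"
    using exp_uniform_approx by blast
  let ?g = "\<lambda>z. \<Sum>i<n. (a \<bullet> z) ^ i *\<^sub>R ((1 / fact i) *\<^sub>R v)"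
  have "?g \<in> V" by (intro sum ridge_power) auto
  moreover have "norm (exp (a \<bullet> z) *\<^sub>R v - ?g z) \<le> e" if "norm z \<le> R" for z
  proof -
    have "\<bar>a \<bullet> z\<bar> \<le> norm a * R"
      using Cauchy_Schwarz_ineq2[of a z] that by (meson mult_left_mono norm_ge_zero order_trans)
    note n[OF this]
    moreover have "exp (a \<bullet> z) *\<^sub>R v - ?g z = (exp (a \<bullet> z) - (\<Sum>i<n. (a \<bullet> z) ^ i / fact i)) *\<^sub>R v"
      by (simp add: scaleR_left_diff_distrib scaleR_sum_left)
    ultimately have "norm (exp (a \<bullet> z) *\<^sub>R v - ?g z) \<le> e / (norm v + 1) * norm v"
      by (simp only: norm_scaleR real_norm_def) (intro mult_right_mono, auto)
    also have "\<dots> \<le> e / (norm v + 1) * (norm v + 1)"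
      using \<open>e / (norm v + 1) > 0\<close> by (intro mult_left_mono) auto
    finally show ?thesis by (simp add: add_nonneg_pos less_imp_neq[symmetric])
  qed
  ultimately show "\<exists>g\<in>V. \<forall>z. norm z \<le> R \<longrightarrow> norm (exp (a \<bullet> z) *\<^sub>R v - g z) \<le> e"
    by (intro bexI[of _ ?g] allI impI)
qed

lemma exp_span_mem: "g \<in> exp_span \<Longrightarrow> (\<lambda>z. g z *\<^sub>R v) \<in> V"
proof (induction rule: exp_span.induct)
  case (ridge c a)
  then show ?case using ridge_exp[of a "c *\<^sub>R v"] by (simp add: mult.commute)
next
  case (plus f g)
  show ?case using add[OF plus.IH] by (simp add: scaleR_left_distrib)
qed

lemma scalar_continuous_mem:
  assumes f: "continuous_on UNIV f"
  shows "(\<lambda>z. f z *\<^sub>R v) \<in> V"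
proof (rule lim)
  show "continuous_on UNIV (\<lambda>z. f z *\<^sub>R v)" by (intro continuous_intros f)
next
  fix R e :: real
  assume "e > 0"
  then have e': "e / (norm v + 1) > 0" by (simp add: add_nonneg_pos)
  obtain g where g: "g \<in> exp_span" "\<And>x. x \<in> cball 0 R \<Longrightarrow> \<bar>f x - g x\<bar> < e / (norm v + 1)"
    using exp_span_dense[OF compact_cball continuous_on_subset[OF f subset_UNIV] e', of 0 R] by blast
  have "norm (f z *\<^sub>R v - g z *\<^sub>R v) \<le> e" if "norm z \<le> R" for z
  proof -
    have "norm (f z *\<^sub>R v - g z *\<^sub>R v) = \<bar>f z - g z\<bar> * norm v"
      by (simp flip: scaleR_left_diff_distrib)
    also have "\<dots> \<le> e / (norm v + 1) * (norm v + 1)"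
      using g(2)[of z] that e' by (intro mult_mono) auto
    finally show ?thesis by (simp add: add_nonneg_pos less_imp_neq[symmetric])
  qed
  then show "\<exists>h\<in>V. \<forall>z. norm z \<le> R \<longrightarrow> norm (f z *\<^sub>R v - h z) \<le> e"
    by (intro bexI[OF _ exp_span_mem[OF g(1), of v]] allI impI)
qed

lemma continuous_mem:
  assumes f: "continuous_on UNIV f"
  shows "f \<in> V"
proof -
  have "(\<lambda>z. \<Sum>b\<in>Basis. (f z \<bullet> b) *\<^sub>R b) \<in> V"
    by (intro sum scalar_continuous_mem continuous_intros f finite_Basis)
  then show ?thesis by (simp add: euclidean_representation)
qed

end

subsection \<open>Vector fields approximated by Euler steps\<close>

lemma uniform_delta_cball:
  fixes f :: "'a::euclidean_space \<Rightarrow> 'b::metric_space"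
  assumes "continuous_on UNIV f" "e > 0"
  obtains d where "d > 0" "\<And>x y. norm x \<le> R \<Longrightarrow> norm y \<le> R \<Longrightarrow> dist x y < d \<Longrightarrow> dist (f x) (f y) < e"
proof -
  have "uniformly_continuous_on (cball 0 R) f"
    using assms by (intro compact_uniformly_continuous) (auto intro: continuous_on_subset)
  then have "\<exists>d>0. \<forall>x\<in>cball 0 R. \<forall>y\<in>cball 0 R. dist y x < d \<longrightarrow> dist (f y) (f x) < e"
    unfolding uniformly_continuous_on_def using \<open>e > 0\<close> by simp
  then obtain d where d: "d > 0" "\<forall>x\<in>cball 0 R. \<forall>y\<in>cball 0 R. dist y x < d \<longrightarrow> dist (f y) (f x) < e"
    by blast
  show ?thesis
  proof (rule that[OF d(1)])
    fix x y :: 'a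
    assume "norm x \<le> R" "norm y \<le> R" "dist x y < d"
    then show "dist (f x) (f y) < e"
      using d(2)[rule_format, of y x] by simp
  qed
qed

text \<open>The map \<open>\<Phi>\<close> may depend on \<open>h\<close>, \<open>R\<close> and
  \<open>\<eta>\<close>. Asking for all small \<open>h\<close>, not just a sequence, lets two fields
  be composed with the same step and lets a time interval be cut into equal steps.\<close>

definition euler_fields :: "('b::euclidean_space \<Rightarrow> 'b) set \<Rightarrow> ('b \<Rightarrow> 'b) set" where
  "euler_fields A = {V. continuous_on UNIV V \<and>
     (\<forall>R \<eta>. \<eta> > 0 \<longrightarrow> (\<exists>h0>0. \<forall>h. 0 < h \<and> h < h0 \<longrightarrow>
        (\<exists>\<Phi>\<in>A. \<forall>z. norm z \<le> R \<longrightarrow> norm (\<Phi> z - z - h *\<^sub>R V z) \<le> \<eta> * h)))}"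

lemma euler_fieldsI:
  assumes "continuous_on UNIV V"
    and "\<And>R \<eta>. \<eta> > 0 \<Longrightarrow> \<exists>h0>0. \<forall>h. 0 < h \<and> h < h0 \<longrightarrow>
      (\<exists>\<Phi>\<in>A. \<forall>z. norm z \<le> R \<longrightarrow> norm (\<Phi> z - z - h *\<^sub>R V z) \<le> \<eta> * h)"
  shows "V \<in> euler_fields A"
  using assms unfolding euler_fields_def by simp

lemma euler_fieldsE:
  assumes "V \<in> euler_fields A" "\<eta> > 0"
  obtains h0 where "h0 > 0" "\<And>h. 0 < h \<Longrightarrow> h < h0 \<Longrightarrow>
    \<exists>\<Phi>\<in>A. \<forall>z. norm z \<le> R \<longrightarrow> norm (\<Phi> z - z - h *\<^sub>R V z) \<le> \<eta> * h"
proof -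
  have "\<exists>h0>0. \<forall>h. 0 < h \<and> h < h0 \<longrightarrow>
      (\<exists>\<Phi>\<in>A. \<forall>z. norm z \<le> R \<longrightarrow> norm (\<Phi> z - z - h *\<^sub>R V z) \<le> \<eta> * h)"
    using assms unfolding euler_fields_def by simp
  then obtain h0 where "h0 > 0" and h0: "\<forall>h. 0 < h \<and> h < h0 \<longrightarrow>
      (\<exists>\<Phi>\<in>A. \<forall>z. norm z \<le> R \<longrightarrow> norm (\<Phi> z - z - h *\<^sub>R V z) \<le> \<eta> * h)"
    by (elim exE conjE)
  show ?thesis
    by (rule that[OF \<open>h0 > 0\<close>]) (rule h0[rule_format, OF conjI])
qed

lemma euler_fields_continuous: "V \<in> euler_fields A \<Longrightarrow> continuous_on UNIV V"
  by (simp add: euler_fields_def)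

text \<open>Replacing \<open>f\<close> by \<open>g\<close> changes an Euler step by \<open>h\<close>
  times their distance, which is again an error of the form \<open>\<eta> * h\<close>.\<close>

lemma euler_fields_lim:
  assumes cont: "continuous_on UNIV f"
    and lim: "\<And>R e. e > 0 \<Longrightarrow> \<exists>g\<in>euler_fields A. \<forall>z. norm z \<le> R \<longrightarrow> norm (f z - g z) \<le> e"
  shows "f \<in> euler_fields A"
proof (rule euler_fieldsI[OF cont])
  fix R \<eta> :: real
  assume "\<eta> > 0"
  then obtain g where g: "g \<in> euler_fields A" "\<And>z. norm z \<le> R \<Longrightarrow> norm (f z - g z) \<le> \<eta> / 2"
    using lim[of "\<eta> / 2" R] by auto
  obtain h0 where h0: "h0 > 0" "\<And>h. 0 < h \<Longrightarrow> h < h0 \<Longrightarrow>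
    \<exists>\<Phi>\<in>A. \<forall>z. norm z \<le> R \<longrightarrow> norm (\<Phi> z - z - h *\<^sub>R g z) \<le> \<eta> / 2 * h"
    using euler_fieldsE[OF g(1), of "\<eta> / 2" R] \<open>\<eta> > 0\<close> by auto
  have "\<exists>\<Phi>\<in>A. \<forall>z. norm z \<le> R \<longrightarrow> norm (\<Phi> z - z - h *\<^sub>R f z) \<le> \<eta> * h" if h: "0 < h" "h < h0" for h
  proof -
    obtain \<Phi> where \<Phi>: "\<Phi> \<in> A" "\<And>z. norm z \<le> R \<Longrightarrow> norm (\<Phi> z - z - h *\<^sub>R g z) \<le> \<eta> / 2 * h"
      using h0(2)[OF h] by blast
    have "norm (\<Phi> z - z - h *\<^sub>R f z) \<le> \<eta> * h" if z: "norm z \<le> R" for z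
    proof -
      have "\<Phi> z - z - h *\<^sub>R f z = (\<Phi> z - z - h *\<^sub>R g z) - h *\<^sub>R (f z - g z)"
        by (simp add: scaleR_diff_right)
      also have "norm \<dots> \<le> \<eta> / 2 * h + h * (\<eta> / 2)"
      proof (rule norm_triangle_le_diff, rule add_mono, rule \<Phi>(2)[OF z])
        show "norm (h *\<^sub>R (f z - g z)) \<le> h * (\<eta> / 2)"
          unfolding norm_scaleR using g(2)[OF z] h by (intro mult_mono) auto
      qed
      finally show ?thesis by simp
    qed
    then show ?thesis by (intro bexI[OF _ \<Phi>(1)] allI impI)
  qed
  then show "\<exists>h0>0. \<forall>h. 0 < h \<and> h < h0 \<longrightarrow>
      (\<exists>\<Phi>\<in>A. \<forall>z. norm z \<le> R \<longrightarrow> norm (\<Phi> z - z - h *\<^sub>R f z) \<le> \<eta> * h)"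
    using h0(1) by (intro exI[of _ h0]) simp
qed

text \<open>McShane's extension of \<open>u \<circ> G\<^sup>-\<^sup>1\<close>, taken coordinate by coordinate.\<close>

lemma lipschitz_field_extension:
  fixes G u :: "'a \<Rightarrow> 'b::euclidean_space"
  assumes "K \<noteq> {}" and B: "\<And>x. x \<in> K \<Longrightarrow> norm (u x) \<le> B"
    and L: "L \<ge> 0" "\<And>x y. x \<in> K \<Longrightarrow> y \<in> K \<Longrightarrow> norm (u x - u y) \<le> L * norm (G x - G y)"
  shows "\<exists>V. (\<forall>z w. norm (V z - V w) \<le> real DIM('b) * L * norm (z - w)) \<and> (\<forall>x\<in>K. V (G x) = u x)"
proof -
  define q where "q i z x = u x \<bullet> i + L * norm (z - G x)" for i z x
  define v where "v i z = (INF x\<in>K. q i z x)" for i z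
  define V where "V z = (\<Sum>i\<in>Basis. v i z *\<^sub>R i)" for z
  have bdd: "bdd_below (q i z ` K)" if "i \<in> Basis" for i z
  proof (rule bdd_belowI2)
    fix x assume "x \<in> K"
    then have "- B \<le> u x \<bullet> i" using B[of x] Basis_le_norm[OF that, of "u x"] by linarith
    moreover have "0 \<le> L * norm (z - G x)" using L(1) by simp
    ultimately show "- B \<le> q i z x" by (simp add: q_def)
  qed
  have le: "v i z \<le> q i z x" if "i \<in> Basis" "x \<in> K" for i z x
    unfolding v_def by (rule cINF_lower[OF bdd[OF that(1)] that(2)])
  have half: "v i z - L * norm (z - w) \<le> v i w" if i: "i \<in> Basis" for i z w
    unfolding v_def[of i w]
  proof (rule cINF_greatest[OF \<open>K \<noteq> {}\<close>])
    fix x assume "x \<in> K"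
    have "norm (z - G x) \<le> norm (z - w) + norm (w - G x)"
      by (rule norm_diff_triangle_le[OF order_refl order_refl])
    then have "L * norm (z - G x) \<le> L * norm (z - w) + L * norm (w - G x)"
      using L(1) by (metis distrib_left mult_left_mono)
    then show "v i z - L * norm (z - w) \<le> q i w x"
      using le[OF i \<open>x \<in> K\<close>, of z] by (simp add: q_def)
  qed
  have lip: "\<bar>v i z - v i w\<bar> \<le> L * norm (z - w)" if i: "i \<in> Basis" for i z w
    using half[OF i, of z w] half[OF i, of w z] by (simp add: norm_minus_commute abs_le_iff)
  have eq: "v i (G x) = u x \<bullet> i" if i: "i \<in> Basis" and x: "x \<in> K" for i x
  proof (rule antisym)
    show "v i (G x) \<le> u x \<bullet> i" using le[OF i x, of "G x"] by (simp add: q_def)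
    show "u x \<bullet> i \<le> v i (G x)"
      unfolding v_def
    proof (rule cINF_greatest[OF \<open>K \<noteq> {}\<close>])
      fix y assume y: "y \<in> K"
      have "(u x - u y) \<bullet> i \<le> norm (u x - u y)" using Basis_le_norm[OF i, of "u x - u y"] by simp
      then show "u x \<bullet> i \<le> q i (G x) y" using L(2)[OF x y] by (simp add: q_def inner_diff_left)
    qed
  qed
  have comp: "V z \<bullet> i = v i z" if "i \<in> Basis" for i z
    using that by (simp add: V_def inner_sum_left inner_Basis if_distrib sum.delta cong: if_cong)
  have "norm (V z - V w) \<le> real DIM('b) * L * norm (z - w)" for z w
  proof -
    \<comment> \<open>Each coordinate is \<open>L\<close>-Lipschitz; bounding the norm by the sum
      over coordinates produces the factor \<open>DIM('b)\<close>.\<close>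
    have "norm (V z - V w) \<le> (\<Sum>i\<in>Basis. \<bar>(V z - V w) \<bullet> i\<bar>)" by (rule norm_le_l1)
    also have "\<dots> \<le> (\<Sum>i\<in>(Basis::'b set). L * norm (z - w))"
      by (rule sum_mono) (simp add: inner_diff_left comp lip)
    finally show ?thesis by simp
  qed
  moreover have "V (G x) = u x" if "x \<in> K" for x
    by (rule euclidean_eqI) (simp add: comp eq that)
  ultimately show ?thesis by blast
qed

section \<open>Compositions of maps and the fields they follow\<close>

locale map_monoid =
  fixes A :: "('b::euclidean_space \<Rightarrow> 'b) set"
  assumes ident: "(\<lambda>z. z) \<in> A"
    and comp: "\<Phi> \<in> A \<Longrightarrow> \<Psi> \<in> A \<Longrightarrow> (\<lambda>z. \<Phi> (\<Psi> z)) \<in> A"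
begin

text \<open>A step along \<open>g\<close> followed by a step along \<open>f\<close> is a step along
  the sum, except that \<open>f\<close> is evaluated at a point displaced by \<open>O(h)\<close>.
  Uniform continuity of \<open>f\<close> makes this error \<open>o(h)\<close>.\<close>

lemma euler_fields_add:
  assumes f: "f \<in> euler_fields A" and g: "g \<in> euler_fields A"
  shows "(\<lambda>z. f z + g z) \<in> euler_fields A"
proof (rule euler_fieldsI)
  show "continuous_on UNIV (\<lambda>z. f z + g z)"
    by (intro continuous_intros euler_fields_continuous[OF f] euler_fields_continuous[OF g])
next
  fix R \<eta> :: real
  assume \<eta>: "\<eta> > 0"
  have e3: "\<eta> / 3 > 0" using \<eta> by simp
  obtain d where d: "d > 0" "\<And>x y. norm x \<le> \<bar>R\<bar> + 1 \<Longrightarrow> norm y \<le> \<bar>R\<bar> + 1 \<Longrightarrow> dist x y < d \<Longrightarrow> dist (f x) (f y) < \<eta> / 3"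
    using uniform_delta_cball[OF euler_fields_continuous[OF f] e3] by blast
  obtain hf where hf: "hf > 0" "\<And>h. 0 < h \<Longrightarrow> h < hf \<Longrightarrow>
    \<exists>\<Phi>\<in>A. \<forall>z. norm z \<le> \<bar>R\<bar> + 1 \<longrightarrow> norm (\<Phi> z - z - h *\<^sub>R f z) \<le> \<eta> / 3 * h"
    using euler_fieldsE[OF f e3] by blast
  obtain hg where hg: "hg > 0" "\<And>h. 0 < h \<Longrightarrow> h < hg \<Longrightarrow>
    \<exists>\<Phi>\<in>A. \<forall>z. norm z \<le> R \<longrightarrow> norm (\<Phi> z - z - h *\<^sub>R g z) \<le> \<eta> / 3 * h"
    using euler_fieldsE[OF g e3] by blast
  have "compact (g ` cball 0 R)"
    by (intro compact_continuous_image continuous_on_subset[OF euler_fields_continuous[OF g]]) auto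
  then obtain B where "B > 0" and B: "\<And>z. z \<in> cball 0 R \<Longrightarrow> norm (g z) \<le> B"
    using compact_imp_bounded bounded_pos by (metis imageI)
  \<comment> \<open>The last two bounds make the displacement \<open>h * (B + \<eta>)\<close>
    smaller than \<open>1\<close>, so that \<open>\<Psi> z\<close> stays in the larger ball, and
    smaller than the modulus \<open>d\<close> of \<open>f\<close>.\<close>
  define h0 where "h0 = Min {hf, hg, 1 / (B + \<eta>), d / (B + \<eta>)}"
  have h0: "h0 > 0" using hf(1) hg(1) d(1) \<open>B > 0\<close> \<eta> by (simp add: h0_def)
  have "\<exists>\<Phi>\<in>A. \<forall>z. norm z \<le> R \<longrightarrow> norm (\<Phi> z - z - h *\<^sub>R (f z + g z)) \<le> \<eta> * h"
    if h: "0 < h" "h < h0" for h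
  proof -
    have "h < hf" "h < hg" "h < 1 / (B + \<eta>)" "h < d / (B + \<eta>)" using h by (auto simp: h0_def)
    then have small: "h * (B + \<eta>) < 1" "h * (B + \<eta>) < d"
      using \<open>B > 0\<close> \<eta> by (simp_all add: pos_less_divide_eq)
    obtain \<Phi> where \<Phi>: "\<Phi> \<in> A" "\<And>z. norm z \<le> \<bar>R\<bar> + 1 \<Longrightarrow> norm (\<Phi> z - z - h *\<^sub>R f z) \<le> \<eta> / 3 * h"
      using hf(2)[OF h(1) \<open>h < hf\<close>] by blast
    obtain \<Psi> where \<Psi>: "\<Psi> \<in> A" "\<And>z. norm z \<le> R \<Longrightarrow> norm (\<Psi> z - z - h *\<^sub>R g z) \<le> \<eta> / 3 * h"
      using hg(2)[OF h(1) \<open>h < hg\<close>] by blast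
    have "norm (\<Phi> (\<Psi> z) - z - h *\<^sub>R (f z + g z)) \<le> \<eta> * h" if z: "norm z \<le> R" for z
    proof -
      have "norm (h *\<^sub>R g z) \<le> h * B" using B[of z] z h by (simp add: mult_left_mono)
      moreover have "norm (\<Psi> z - z) \<le> norm (\<Psi> z - z - h *\<^sub>R g z) + norm (h *\<^sub>R g z)"
        using norm_triangle_ineq[of "\<Psi> z - z - h *\<^sub>R g z" "h *\<^sub>R g z"] by simp
      moreover have "\<eta> / 3 * h \<le> \<eta> * h" using \<eta> h by simp
      ultimately have disp: "norm (\<Psi> z - z) \<le> h * (B + \<eta>)"
        using \<Psi>(2)[OF z] by (simp add: algebra_simps)
      have \<Psi>R: "norm (\<Psi> z) \<le> \<bar>R\<bar> + 1"
        using norm_triangle_ineq[of "\<Psi> z - z" z] disp small(1) z by simp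
      have "dist (f (\<Psi> z)) (f z) < \<eta> / 3"
        using \<Psi>R disp small(2) z by (intro d(2)) (auto simp: dist_norm)
      then have 3: "norm (h *\<^sub>R (f (\<Psi> z) - f z)) \<le> h * (\<eta> / 3)"
        using h by (simp add: dist_norm)
      have "\<Phi> (\<Psi> z) - z - h *\<^sub>R (f z + g z)
          = (\<Phi> (\<Psi> z) - \<Psi> z - h *\<^sub>R f (\<Psi> z)) + (\<Psi> z - z - h *\<^sub>R g z) + h *\<^sub>R (f (\<Psi> z) - f z)"
        by (simp add: algebra_simps)
      also have "norm \<dots> \<le> \<eta> / 3 * h + \<eta> / 3 * h + h * (\<eta> / 3)"
        by (intro norm_triangle_le add_mono \<Phi>(2)[OF \<Psi>R] \<Psi>(2)[OF z] 3)
      finally show ?thesis by simp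
    qed
    then show ?thesis by (intro bexI[OF _ comp[OF \<Phi>(1) \<Psi>(1)]] allI impI)
  qed
  then show "\<exists>h0>0. \<forall>h. 0 < h \<and> h < h0 \<longrightarrow>
      (\<exists>\<Phi>\<in>A. \<forall>z. norm z \<le> R \<longrightarrow> norm (\<Phi> z - z - h *\<^sub>R (f z + g z)) \<le> \<eta> * h)"
    using h0 by (intro exI[of _ h0]) simp
qed

text \<open>The profiles whose ridge fields all lie in \<open>euler_fields A\<close> form an
  affine-invariant closed space containing \<open>\<sigma>\<close>, hence all powers. Ridge powers
  in turn generate every continuous field.\<close>

lemma continuous_in_euler_fields:
  assumes shear: "\<And>a b v. (\<lambda>z. z + \<sigma> (a \<bullet> z + b) *\<^sub>R v) \<in> A"
    and cont: "continuous_on UNIV \<sigma>" and nonpoly: "\<not> (\<exists>p. \<forall>x. \<sigma> x = poly p x)"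
    and W: "continuous_on UNIV W"
  shows "W \<in> euler_fields A"
proof -
  define M where "M = {g. continuous_on UNIV g \<and> (\<forall>a b v. (\<lambda>z. g (a \<bullet> z + b) *\<^sub>R v) \<in> euler_fields A)}"
  have zero: "(\<lambda>z. 0) \<in> euler_fields A"
    by (rule euler_fieldsI) (use ident in \<open>auto intro!: exI[of _ 1] bexI[of _ "\<lambda>z. z"]\<close>)
  interpret M: affine_invariant_space M
  proof
    fix f assume f: "f \<in> M"
    then show "continuous_on UNIV f" by (simp add: M_def)
    fix c
    have "(\<lambda>z. (c * f (a \<bullet> z + b)) *\<^sub>R v) \<in> euler_fields A" for a b v
    proof -
      have "(\<lambda>z. f (a \<bullet> z + b) *\<^sub>R (c *\<^sub>R v)) \<in> euler_fields A" using f unfolding M_def by blast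
      then show ?thesis by (simp add: mult.commute)
    qed
    then show "(\<lambda>t. c * f t) \<in> M" using f by (auto simp: M_def intro!: continuous_intros)
  next
    fix f l b assume f: "f \<in> M"
    have "(\<lambda>z. f (l * (a \<bullet> z + b') + b) *\<^sub>R v) \<in> euler_fields A" for a b' v
    proof -
      have "(\<lambda>z. f ((l *\<^sub>R a) \<bullet> z + (l * b' + b)) *\<^sub>R v) \<in> euler_fields A" using f unfolding M_def by blast
      then show ?thesis by (simp add: distrib_left add.assoc)
    qed
    moreover have "continuous_on UNIV (\<lambda>t. f (l * t + b))"
      using f unfolding M_def by (auto intro!: continuous_on_compose2[of UNIV f] continuous_intros)
    ultimately show "(\<lambda>t. f (l * t + b)) \<in> M" by (simp add: M_def)
  next
    fix f assume f: "continuous_on UNIV f"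
      and lim: "\<And>R e. e > 0 \<Longrightarrow> \<exists>g\<in>M. \<forall>t. \<bar>t\<bar> \<le> R \<longrightarrow> \<bar>f t - g t\<bar> \<le> e"
    have "(\<lambda>z. f (a \<bullet> z + b) *\<^sub>R v) \<in> euler_fields A" for a b v
    proof (rule euler_fields_lim)
      show "continuous_on UNIV (\<lambda>z. f (a \<bullet> z + b) *\<^sub>R v)"
        by (intro continuous_intros continuous_on_compose2[OF f]) auto
    next
      fix R e :: real
      assume "e > 0"
      then have e': "e / (norm v + 1) > 0" by (simp add: add_nonneg_pos)
      obtain g where g: "g \<in> M" "\<And>t. \<bar>t\<bar> \<le> norm a * R + \<bar>b\<bar> \<Longrightarrow> \<bar>f t - g t\<bar> \<le> e / (norm v + 1)"
        using lim[OF e', of "norm a * R + \<bar>b\<bar>"] by blast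
      have mem: "(\<lambda>z. g (a \<bullet> z + b) *\<^sub>R v) \<in> euler_fields A" using g(1) by (simp add: M_def)
      have "norm (f (a \<bullet> z + b) *\<^sub>R v - g (a \<bullet> z + b) *\<^sub>R v) \<le> e" if z: "norm z \<le> R" for z
      proof -
        have "\<bar>a \<bullet> z\<bar> \<le> norm a * R"
          using Cauchy_Schwarz_ineq2[of a z] z by (meson mult_left_mono norm_ge_zero order_trans)
        then have "\<bar>f (a \<bullet> z + b) - g (a \<bullet> z + b)\<bar> \<le> e / (norm v + 1)" by (intro g(2)) simp
        moreover have "norm (f (a \<bullet> z + b) *\<^sub>R v - g (a \<bullet> z + b) *\<^sub>R v) = \<bar>f (a \<bullet> z + b) - g (a \<bullet> z + b)\<bar> * norm v"
          by (simp flip: scaleR_left_diff_distrib)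
        ultimately have "norm (f (a \<bullet> z + b) *\<^sub>R v - g (a \<bullet> z + b) *\<^sub>R v) \<le> e / (norm v + 1) * (norm v + 1)"
          using e' by (simp only:) (intro mult_mono, auto)
        then show ?thesis by (simp add: add_nonneg_pos less_imp_neq[symmetric])
      qed
      then show "\<exists>h\<in>euler_fields A. \<forall>z. norm z \<le> R \<longrightarrow> norm (f (a \<bullet> z + b) *\<^sub>R v - h z) \<le> e"
        by (intro bexI[OF _ mem] allI impI)
    qed
    then show "f \<in> M" using f by (simp add: M_def)
  qed (use zero in \<open>auto simp: M_def scaleR_left_distrib intro!: continuous_intros euler_fields_add\<close>)
  \<comment> \<open>The shear along \<open>h *\<^sub>R v\<close> is an exact Euler step for this
    field, with error zero.\<close>
  have "(\<lambda>z. \<sigma> (a \<bullet> z + b) *\<^sub>R v) \<in> euler_fields A" for a b v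
  proof (rule euler_fieldsI)
    show "continuous_on UNIV (\<lambda>z. \<sigma> (a \<bullet> z + b) *\<^sub>R v)"
      by (intro continuous_intros continuous_on_compose2[OF cont]) auto
    fix R \<eta> :: real
    assume "\<eta> > 0"
    have "\<exists>\<Phi>\<in>A. \<forall>z. norm z \<le> R \<longrightarrow> norm (\<Phi> z - z - h *\<^sub>R (\<sigma> (a \<bullet> z + b) *\<^sub>R v)) \<le> \<eta> * h" if "h > 0" for h
      using \<open>\<eta> > 0\<close> that by (intro bexI[OF _ shear[of a b "h *\<^sub>R v"]]) (simp add: mult.commute)
    then show "\<exists>h0>0. \<forall>h. 0 < h \<and> h < h0 \<longrightarrow>
      (\<exists>\<Phi>\<in>A. \<forall>z. norm z \<le> R \<longrightarrow> norm (\<Phi> z - z - h *\<^sub>R (\<sigma> (a \<bullet> z + b) *\<^sub>R v)) \<le> \<eta> * h)"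
      by (intro exI[of _ 1]) simp
  qed
  then have "\<sigma> \<in> M" using cont by (simp add: M_def)
  have power: "(\<lambda>z. (a \<bullet> z) ^ k *\<^sub>R v) \<in> euler_fields A" for a k v
  proof -
    have "(\<lambda>z. (a \<bullet> z + 0) ^ k *\<^sub>R v) \<in> euler_fields A"
      using M.power_mem[OF \<open>\<sigma> \<in> M\<close> nonpoly, of k] unfolding M_def by blast
    then show ?thesis by simp
  qed
  interpret ridge_closed_space "euler_fields A"
    by unfold_locales (auto intro: euler_fields_add euler_fields_lim power)
  show ?thesis by (rule continuous_mem[OF W])
qed

text \<open>Time is cut into slices of length \<open>T\<close>. On each slice the velocity is frozen
  at the initial time and extended to a Lipschitz field on the whole space, which is followed by
  Euler steps. A discrete Gronwall estimate controls the accumulated error.\<close>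

lemma isotopy_endpoint:
  fixes G u :: "real \<Rightarrow> 'a::euclidean_space \<Rightarrow> 'b"
  assumes fields: "\<And>V. continuous_on UNIV V \<Longrightarrow> V \<in> euler_fields A"
    and K: "compact K" and G0: "bounded (G 0 ` K)"
    and der: "\<And>t x. x \<in> K \<Longrightarrow> ((\<lambda>t. G t x) has_vector_derivative u t x) (at t)"
    and ucont: "continuous_on ({0..1} \<times> K) (\<lambda>(t, x). u t x)"
    and L: "L \<ge> 0" "\<And>t x y. 0 \<le> t \<Longrightarrow> t \<le> 1 \<Longrightarrow> x \<in> K \<Longrightarrow> y \<in> K \<Longrightarrow>
      norm (u t x - u t y) \<le> L * norm (G t x - G t y)"
    and e: "e > 0"
  shows "\<exists>\<Phi>\<in>A. \<forall>x\<in>K. norm (\<Phi> (G 0 x) - G 1 x) \<le> e"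
proof (cases "K = {}")
  case True
  then show ?thesis using ident by (intro bexI[of _ "\<lambda>z. z"]) auto
next
  case False
  define L' where "L' = real DIM('b) * L"
  have L': "L' \<ge> 0" using L(1) by (simp add: L'_def)
  have comp_prod: "compact ({0..1::real} \<times> K)" by (intro compact_Times K compact_Icc)
  have "bounded ((\<lambda>(t, x). u t x) ` ({0..1} \<times> K))"
    by (intro compact_imp_bounded compact_continuous_image ucont comp_prod)
  then obtain B where B0: "B > 0" and B': "\<And>y. y \<in> (\<lambda>(t, x). u t x) ` ({0..1} \<times> K) \<Longrightarrow> norm y \<le> B"
    using bounded_pos by metis
  have B: "norm (u t x) \<le> B" if "0 \<le> t" "t \<le> 1" "x \<in> K" for t x
    using that by (intro B') (auto intro!: image_eqI[of _ _ "(t, x)"])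
  \<comment> \<open>Chosen so that the final error \<open>\<kappa> * exp L'\<close> is
    \<open>min e 1\<close>; the bound \<open>1\<close> confines the approximate trajectories to a
    fixed ball. In \<open>\<kappa>\<close>, the \<open>2\<close> counts the Euler error and the
    freezing error, and \<open>L'\<close> the drift of \<open>G\<close> within a slice.\<close>
  define \<eta> where "\<eta> = min e 1 / ((2 + L') * exp L')"
  have \<eta>: "\<eta> > 0" using e L' by (simp add: \<eta>_def add_pos_nonneg)
  define \<kappa> where "\<kappa> = (2 + L') * \<eta>"
  have "2 + L' \<noteq> 0" using L' by simp
  then have \<kappa>: "\<kappa> > 0" "\<kappa> * exp L' = min e 1"
    using \<eta> L' by (simp_all add: \<kappa>_def, simp add: \<eta>_def)
  have "uniformly_continuous_on ({0..1} \<times> K) (\<lambda>(t, x). u t x)"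
    by (rule compact_uniformly_continuous[OF ucont comp_prod])
  then have "\<exists>\<delta>>0. \<forall>p\<in>{0..1} \<times> K. \<forall>q\<in>{0..1} \<times> K. dist q p < \<delta> \<longrightarrow>
      dist ((\<lambda>(t, x). u t x) q) ((\<lambda>(t, x). u t x) p) < \<eta>"
    unfolding uniformly_continuous_on_def using \<eta> by simp
  then obtain \<delta> where \<delta>0: "\<delta> > 0" and \<delta>': "\<forall>p\<in>{0..1} \<times> K. \<forall>q\<in>{0..1} \<times> K. dist q p < \<delta> \<longrightarrow>
      dist ((\<lambda>(t, x). u t x) q) ((\<lambda>(t, x). u t x) p) < \<eta>"
    by (elim exE conjE)
  have \<delta>: "norm (u t x - u s x) \<le> \<eta>"
    if "0 \<le> s" "s \<le> 1" "0 \<le> t" "t \<le> 1" "\<bar>t - s\<bar> < \<delta>" "x \<in> K" for s t x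
    using \<delta>'[rule_format, of "(s, x)" "(t, x)"] that by (simp add: dist_Pair_Pair dist_norm)
  \<comment> \<open>The two summands make the slice length \<open>T = 1 / N\<close> shorter than
    \<open>\<delta>\<close>, and short enough for \<open>G\<close> to move by at most
    \<open>\<eta>\<close> within a slice.\<close>
  obtain N :: nat where N: "1 / \<delta> + (B + \<eta>) / \<eta> < real N" using reals_Archimedean2 by blast
  have "1 / \<delta> > 0" "(B + \<eta>) / \<eta> > 0" using \<delta>0 B0 \<eta> by auto
  then have N1: "1 / \<delta> < real N" "(B + \<eta>) / \<eta> < real N" using N by linarith+
  then have N0: "real N > 0" using \<open>1 / \<delta> > 0\<close> by linarith
  define T where "T = 1 / real N"
  have T: "T > 0" "T < \<delta>" "T * (B + \<eta>) \<le> \<eta>"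
    using N1 N0 \<delta>0 \<eta> by (auto simp: T_def field_simps)
  have lin: "norm (G t x - G s x - (t - s) *\<^sub>R u r x) \<le> (t - s) * \<eta>"
    if "0 \<le> r" "r \<le> s" "s \<le> t" "t \<le> 1" "t \<le> r + T" "x \<in> K" for r s t x
  proof -
    have "norm (G t x - G s x - (t - s) *\<^sub>R u r x) \<le> norm (t - s) * \<eta>"
    proof (rule vector_differentiable_bound_linearization[where S = "{r..t}"])
      show "closed_segment s t \<subseteq> {r..t}" using that by (simp add: closed_segment_eq_real_ivl)
      show "((\<lambda>t. G t x) has_vector_derivative u \<tau> x) (at \<tau> within {r..t})" for \<tau>
        by (rule has_vector_derivative_at_within[OF der[OF \<open>x \<in> K\<close>]])
      show "norm (u \<tau> x - u r x) \<le> \<eta>" if "\<tau> \<in> {r..t}" for \<tau>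
        using that \<open>0 \<le> r\<close> \<open>t \<le> 1\<close> \<open>t \<le> r + T\<close> T \<open>x \<in> K\<close> by (intro \<delta>) auto
    qed (use that in auto)
    then show ?thesis using that by simp
  qed
  have disp: "norm (G t x - G s x) \<le> \<eta>"
    if "0 \<le> s" "s \<le> t" "t \<le> 1" "t \<le> s + T" "x \<in> K" for s t x
  proof -
    have "norm (G t x - G s x) \<le> norm (G t x - G s x - (t - s) *\<^sub>R u s x) + norm ((t - s) *\<^sub>R u s x)"
      using norm_triangle_ineq[of "G t x - G s x - (t - s) *\<^sub>R u s x" "(t - s) *\<^sub>R u s x"] by simp
    also have "\<dots> \<le> (t - s) * \<eta> + (t - s) * B"
      unfolding norm_scaleR using that by (intro add_mono lin mult_mono B) auto
    also have "\<dots> = (t - s) * (B + \<eta>)" by (simp add: algebra_simps)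
    also have "\<dots> \<le> T * (B + \<eta>)" using that B0 \<eta> by (intro mult_right_mono) auto
    finally show ?thesis using T(3) by simp
  qed
  obtain R0 where R0: "\<And>x. x \<in> K \<Longrightarrow> norm (G 0 x) \<le> R0"
    using G0 unfolding bounded_iff by (metis imageI)
  have Gbound: "norm (G t x) \<le> R0 + 3 * B" if "0 \<le> t" "t \<le> 1" "x \<in> K" for t x
  proof -
    have "norm (G t x - G 0 x - (t - 0) *\<^sub>R u 0 x) \<le> norm (t - 0) * (2 * B)"
    proof (rule vector_differentiable_bound_linearization[where S = "{0..1}"])
      show "closed_segment 0 t \<subseteq> {0..1}" using that by (simp add: closed_segment_eq_real_ivl)
      show "((\<lambda>t. G t x) has_vector_derivative u \<tau> x) (at \<tau> within {0..1})" for \<tau>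
        by (rule has_vector_derivative_at_within[OF der[OF \<open>x \<in> K\<close>]])
      show "norm (u \<tau> x - u 0 x) \<le> 2 * B" if "\<tau> \<in> {0..1}" for \<tau>
        using norm_triangle_ineq4[of "u \<tau> x" "u 0 x"] B[of \<tau> x] B[of 0 x] that \<open>x \<in> K\<close> by simp
    qed simp
    then have "norm (G t x - G 0 x - t *\<^sub>R u 0 x) \<le> 2 * B"
      using that B0 by (simp add: mult_left_le_one_le order_trans)
    moreover have "norm (t *\<^sub>R u 0 x) \<le> 1 * B"
      unfolding norm_scaleR using that B[of 0 x] by (intro mult_mono) auto
    moreover have "norm (G t x) \<le> norm (G t x - G 0 x - t *\<^sub>R u 0 x) + norm (G 0 x) + norm (t *\<^sub>R u 0 x)"
      using norm_triangle_ineq[of "G t x - G 0 x - t *\<^sub>R u 0 x" "G 0 x + t *\<^sub>R u 0 x"]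
        norm_triangle_ineq[of "G 0 x" "t *\<^sub>R u 0 x"] by simp
    ultimately show ?thesis using R0[OF \<open>x \<in> K\<close>] by simp
  qed
  \<comment> \<open>The exact trajectories stay within \<open>R0 + 3 * B\<close>; the extra
    \<open>1\<close> leaves room for the approximation error.\<close>
  define R where "R = R0 + 3 * B + 1"
  \<comment> \<open>The Gronwall bound vanishes at \<open>t = 0\<close>, where the identity attains
    it.\<close>
  define reach where "reach t \<longleftrightarrow> (\<exists>\<Phi>\<in>A. \<forall>x\<in>K. norm (\<Phi> (G 0 x) - G t x) \<le> \<kappa> * t * exp (L' * t))" for t
  have substep: "reach (t + h)"
    if t: "reach t" and s: "0 \<le> s" "s \<le> t" and h: "0 < h" "t + h \<le> s + T" "t + h \<le> 1"
      and V: "\<And>z w. norm (V z - V w) \<le> L' * norm (z - w)" "\<And>x. x \<in> K \<Longrightarrow> V (G s x) = u s x"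
      and step: "\<exists>\<Phi>\<in>A. \<forall>z. norm z \<le> R \<longrightarrow> norm (\<Phi> z - z - h *\<^sub>R V z) \<le> \<eta> * h"
    for s t h V
  proof -
    obtain \<Psi> where \<Psi>: "\<Psi> \<in> A" "\<And>x. x \<in> K \<Longrightarrow> norm (\<Psi> (G 0 x) - G t x) \<le> \<kappa> * t * exp (L' * t)"
      using t unfolding reach_def by blast
    obtain \<Phi> where \<Phi>: "\<Phi> \<in> A" "\<And>z. norm z \<le> R \<Longrightarrow> norm (\<Phi> z - z - h *\<^sub>R V z) \<le> \<eta> * h"
      using step by blast
    have "norm (\<Phi> (\<Psi> (G 0 x)) - G (t + h) x) \<le> \<kappa> * (t + h) * exp (L' * (t + h))" if x: "x \<in> K" for x
    proof -
      define z where "z = \<Psi> (G 0 x)"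
      define E where "E = \<kappa> * t * exp (L' * t)"
      have t01: "0 \<le> t" "t \<le> 1" using s h by auto
      have E0: "E \<ge> 0" using t01 \<kappa> by (simp add: E_def)
      have zE: "norm (z - G t x) \<le> E" using \<Psi>(2)[OF x] by (simp add: z_def E_def)
      have "E \<le> \<kappa> * 1 * exp (L' * 1)"
        unfolding E_def using t01 \<kappa> L' by (intro mult_mono) (auto intro: mult_left_le)
      then have "E \<le> 1" using \<kappa> by simp
      then have zR: "norm z \<le> R"
        using norm_triangle_ineq[of "z - G t x" "G t x"] zE Gbound[OF t01 x] by (simp add: R_def)
      have "norm (z - G s x) \<le> norm (z - G t x) + norm (G t x - G s x)"
        by (rule norm_diff_triangle_le[OF order_refl order_refl])
      also have "\<dots> \<le> E + \<eta>" using zE s h x t01 by (intro add_mono disp) auto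
      finally have "L' * norm (z - G s x) \<le> L' * (E + \<eta>)" using L' by (rule mult_left_mono)
      with V(1)[of z "G s x"] have "norm (V z - V (G s x)) \<le> L' * (E + \<eta>)" by linarith
      then have vz: "norm (h *\<^sub>R (V z - V (G s x))) \<le> h * (L' * (E + \<eta>))"
        using h by simp
      have gl: "norm (G (t + h) x - G t x - h *\<^sub>R u s x) \<le> h * \<eta>"
        using lin[of s t "t + h" x] s h x by simp
      have "\<Phi> z - G (t + h) x = (\<Phi> z - z - h *\<^sub>R V z) + (z - G t x)
          + h *\<^sub>R (V z - V (G s x)) - (G (t + h) x - G t x - h *\<^sub>R u s x)"
        using V(2)[OF x] by (simp add: algebra_simps)
      also have "norm \<dots> \<le> \<eta> * h + E + h * (L' * (E + \<eta>)) + h * \<eta>"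
        by (rule norm_triangle_le_diff, rule add_mono[OF norm_triangle_le gl],
            rule add_mono[OF norm_triangle_le vz], rule add_mono[OF \<Phi>(2)[OF zR] zE])
      also have "\<dots> = E * (1 + L' * h) + \<kappa> * h" by (simp add: \<kappa>_def algebra_simps)
      also have "\<dots> \<le> E * exp (L' * h) + \<kappa> * h * exp (L' * (t + h))"
      proof (intro add_mono mult_left_mono exp_ge_add_one_self E0)
        have "1 \<le> exp (L' * (t + h))" using L' t01 h by simp
        then show "\<kappa> * h \<le> \<kappa> * h * exp (L' * (t + h))" using \<kappa>(1) h by (simp add: mult_left_mono)
      qed
      also have "\<dots> = \<kappa> * (t + h) * exp (L' * (t + h))"
        by (simp add: E_def algebra_simps exp_add)
      finally show ?thesis by (simp add: z_def)
    qed
    then show ?thesis unfolding reach_def by (intro bexI[OF _ comp[OF \<Phi>(1) \<Psi>(1)]] ballI)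
  qed
  have piece: "reach (s + T)" if "reach s" "0 \<le> s" "s + T \<le> 1" for s
  proof -
    have s: "0 \<le> s" "s \<le> 1" using that T by auto
    have "\<exists>V. (\<forall>z w. norm (V z - V w) \<le> L' * norm (z - w)) \<and> (\<forall>x\<in>K. V (G s x) = u s x)"
      unfolding L'_def by (rule lipschitz_field_extension[OF False B[OF s] L(1) L(2)[OF s]])
    then obtain V where V: "\<And>z w. norm (V z - V w) \<le> L' * norm (z - w)" "\<And>x. x \<in> K \<Longrightarrow> V (G s x) = u s x"
      by blast
    have "L'-lipschitz_on UNIV V" using V(1) L' by (intro lipschitz_onI) (auto simp: dist_norm)
    then have "V \<in> euler_fields A" by (intro fields lipschitz_on_continuous_on)
    then obtain h0 where h0: "h0 > 0" "\<And>h. 0 < h \<Longrightarrow> h < h0 \<Longrightarrow>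
      \<exists>\<Phi>\<in>A. \<forall>z. norm z \<le> R \<longrightarrow> norm (\<Phi> z - z - h *\<^sub>R V z) \<le> \<eta> * h"
      using euler_fieldsE[OF _ \<eta>] by blast
    obtain m :: nat where m: "T / h0 < real m" using reals_Archimedean2 by blast
    have "T / h0 > 0" using T h0 by simp
    then have m0: "real m > 0" using m by linarith
    define h where "h = T / real m"
    have h: "0 < h" "h < h0" using m m0 T h0(1) by (auto simp: h_def field_simps)
    have mh: "real m * h = T" using m0 by (simp add: h_def)
    have "j \<le> m \<Longrightarrow> reach (s + real j * h)" for j
    proof (induction j)
      case 0
      then show ?case using that by simp
    next
      case (Suc j)
      have "real (Suc j) * h \<le> T"
        unfolding mh[symmetric] using Suc.prems h by (intro mult_right_mono) auto
      then have "reach (s + real j * h + h)"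
        using Suc that h
        by (intro substep[where s = s and V = V and h = h and t = "s + real j * h", OF _ _ _ _ _ _ V h0(2)]) (auto simp: distrib_right)
      then show ?case by (simp add: algebra_simps)
    qed
    from this[of m] show ?thesis by (simp add: mh)
  qed
  have NT: "real N * T = 1" using N0 by (simp add: T_def)
  have "k \<le> N \<Longrightarrow> reach (real k * T)" for k
  proof (induction k)
    case 0
    show ?case using ident by (auto simp: reach_def intro!: bexI[of _ "\<lambda>z. z"])
  next
    case (Suc k)
    have "real (Suc k) * T \<le> 1"
      unfolding NT[symmetric] using Suc.prems T by (intro mult_right_mono) auto
    then have "reach (real k * T + T)" using Suc T by (intro piece) (auto simp: algebra_simps)
    then show ?case by (simp add: algebra_simps)
  qed
  from this[of N] have "reach 1" by (simp add: NT)
  then show ?thesis unfolding reach_def using \<kappa>(2) by auto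
qed

end

subsection \<open>Approximation by embeddings isotopic to a linear map\<close>

text \<open>The maps with such approximations form a \<open>ridge_closed_space\<close>. The constant
  term is split off and all exponents are successors, so that the remaining polynomial map vanishes
  at \<open>0\<close>. Lists of terms make addition a concatenation.\<close>

lemma ridge_polynomial_dense:
  fixes f :: "'a::euclidean_space \<Rightarrow> 'b::euclidean_space"
  assumes f: "continuous_on UNIV f" and "e > 0"
  obtains n :: nat and c a k v where
    "\<And>x. norm x \<le> R \<Longrightarrow> norm (f x - (c + (\<Sum>i<n. (a i \<bullet> x) ^ Suc (k i) *\<^sub>R v i))) \<le> e"
proof -
  define P :: "'b \<Rightarrow> ('a \<times> nat \<times> 'b) list \<Rightarrow> 'a \<Rightarrow> 'b" where
    "P c ts x = c + (\<Sum>t\<leftarrow>ts. (fst t \<bullet> x) ^ Suc (fst (snd t)) *\<^sub>R snd (snd t))" for c ts x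
  define V where "V = {g. \<forall>R e. e > 0 \<longrightarrow> (\<exists>c ts. \<forall>x. norm x \<le> R \<longrightarrow> norm (g x - P c ts x) \<le> e)}"
  have VI: "g \<in> V" if "\<And>R e. e > 0 \<Longrightarrow> \<exists>c ts. \<forall>x. norm x \<le> R \<longrightarrow> norm (g x - P c ts x) \<le> e" for g
    using that by (simp add: V_def)
  have VE: "\<exists>c ts. \<forall>x. norm x \<le> R \<longrightarrow> norm (g x - P c ts x) \<le> e" if "g \<in> V" "e > 0" for g R and e :: real
    using that by (simp add: V_def)
  interpret ridge_closed_space V
  proof
    fix g h assume g: "g \<in> V" and h: "h \<in> V"
    show "(\<lambda>z. g z + h z) \<in> V"
    proof (rule VI)
      fix R e :: real assume "e > 0"
      obtain c ts where 1: "\<And>x. norm x \<le> R \<Longrightarrow> norm (g x - P c ts x) \<le> e / 2"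
        using VE[OF g, of "e / 2" R] \<open>e > 0\<close> by auto
      obtain c' ts' where 2: "\<And>x. norm x \<le> R \<Longrightarrow> norm (h x - P c' ts' x) \<le> e / 2"
        using VE[OF h, of "e / 2" R] \<open>e > 0\<close> by auto
      have "norm (g x + h x - P (c + c') (ts @ ts') x) \<le> e" if "norm x \<le> R" for x
      proof -
        have "g x + h x - P (c + c') (ts @ ts') x = (g x - P c ts x) + (h x - P c' ts' x)"
          by (simp add: P_def)
        also have "norm \<dots> \<le> e / 2 + e / 2"
          by (rule norm_triangle_le, rule add_mono[OF 1[OF that] 2[OF that]])
        finally show ?thesis by simp
      qed
      then show "\<exists>c ts. \<forall>x. norm x \<le> R \<longrightarrow> norm (g x + h x - P c ts x) \<le> e"
        by (intro exI allI impI)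
    qed
  next
    fix g assume lim: "\<And>R e. e > 0 \<Longrightarrow> \<exists>h\<in>V. \<forall>z. norm z \<le> R \<longrightarrow> norm (g z - h z) \<le> e"
    show "g \<in> V"
    proof (rule VI)
      fix R e :: real assume "e > 0"
      obtain h where h: "h \<in> V" and 1: "\<And>x. norm x \<le> R \<Longrightarrow> norm (g x - h x) \<le> e / 2"
        using lim[of "e / 2" R] \<open>e > 0\<close> by auto
      obtain c ts where 2: "\<And>x. norm x \<le> R \<Longrightarrow> norm (h x - P c ts x) \<le> e / 2"
        using VE[OF h, of "e / 2" R] \<open>e > 0\<close> by auto
      have "norm (g x - P c ts x) \<le> e" if "norm x \<le> R" for x
        using norm_diff_triangle_le[OF 1[OF that] 2[OF that]] by simp
      then show "\<exists>c ts. \<forall>x. norm x \<le> R \<longrightarrow> norm (g x - P c ts x) \<le> e"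
        by (intro exI allI impI)
    qed
  next
    fix a k v
    have "\<exists>c ts. \<forall>z. (a \<bullet> z) ^ k *\<^sub>R v = P c ts z"
    proof (cases k)
      case 0
      then show ?thesis by (intro exI[of _ v] exI[of _ "[]"]) (simp add: P_def)
    next
      case (Suc p)
      then show ?thesis by (intro exI[of _ 0] exI[of _ "[(a, p, v)]"]) (simp add: P_def)
    qed
    then obtain c ts where "\<And>z. (a \<bullet> z) ^ k *\<^sub>R v = P c ts z" by blast
    then show "(\<lambda>z. (a \<bullet> z) ^ k *\<^sub>R v) \<in> V"
      by (intro VI exI[of _ c] exI[of _ ts]) simp
  qed
  obtain c ts where c: "\<And>x. norm x \<le> R \<Longrightarrow> norm (f x - P c ts x) \<le> e"
    using VE[OF continuous_mem[OF f] \<open>e > 0\<close>] by blast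
  show ?thesis
  proof (rule that)
    fix x :: 'a assume "norm x \<le> R"
    then show "norm (f x - (c + (\<Sum>i<length ts. (fst (ts ! i) \<bullet> x) ^ Suc (fst (snd (ts ! i))) *\<^sub>R snd (snd (ts ! i))))) \<le> e"
      using c[of x] by (simp add: P_def sum_list_sum_nth atLeast0LessThan)
  qed
qed

text \<open>\<open>Q x r u\<close> stands for the difference quotient \<open>(F (x + r u) - F x) / r\<close>, with the directional derivative
  at \<open>r = 0\<close>. The coefficients \<open>b j\<close> are chosen one index at a time: by homogeneity the forbidden values
  of \<open>b j\<close> come from the directions with \<open>u $ j = 1\<close>, so \<open>x\<close>, \<open>r\<close> and the other coordinates of \<open>u\<close> leave
  only \<open>2n\<close> parameters, with \<open>r\<close> stored in the free slot \<open>j\<close>.\<close>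

lemma linear_perturbation_nonvanishing:
  fixes Q :: "real^'n \<Rightarrow> real \<Rightarrow> real^'n \<Rightarrow> 'b::euclidean_space"
  assumes dim: "2 * CARD('n) < DIM('b)"
    and diff: "(\<lambda>p. Q (fst p) (fst (snd p)) (snd (snd p))) differentiable_on UNIV"
    and hom: "\<And>x r u s. s \<noteq> 0 \<Longrightarrow> Q x (r / s) (s *\<^sub>R u) = s *\<^sub>R Q x r u"
    and "\<delta> > 0"
  obtains b where "\<And>j. norm (b j) \<le> \<delta>"
    "\<And>x r u. u \<noteq> 0 \<Longrightarrow> Q x r u + (\<Sum>j\<in>UNIV. u $ j *\<^sub>R b j) \<noteq> 0"
proof -
  have "\<exists>b. (\<forall>j. norm (b j) \<le> \<delta>) \<and>
      (\<forall>x r u. (\<exists>j\<in>J. u $ j \<noteq> 0) \<longrightarrow> Q x r u + (\<Sum>j\<in>J. u $ j *\<^sub>R b j) \<noteq> 0)" for J :: "'n set"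
    using finite[of J]
  proof (induction J rule: finite_induct)
    case empty
    then show ?case using \<open>\<delta> > 0\<close> by (intro exI[of _ "\<lambda>j. 0"]) auto
  next
    case (insert j J)
    then obtain b where b': "\<forall>i. norm (b i) \<le> \<delta>"
      "\<forall>x r u. (\<exists>i\<in>J. u $ i \<noteq> 0) \<longrightarrow> Q x r u + (\<Sum>j\<in>J. u $ j *\<^sub>R b j) \<noteq> 0"
      by (elim exE conjE)
    have b: "norm (b i) \<le> \<delta>"
      "i \<in> J \<Longrightarrow> u $ i \<noteq> 0 \<Longrightarrow> Q x r u + (\<Sum>j\<in>J. u $ j *\<^sub>R b j) \<noteq> 0" for x r u i
      using b'(1) by (rule spec) (rule b'(2)[rule_format], rule bexI)
    \<comment> \<open>\<open>range \<psi>\<close> consists of the values of \<open>b j\<close> for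
      which the sum vanishes in some direction with coordinate \<open>j\<close> equal to
      \<open>1\<close>. Slot \<open>j\<close> of \<open>snd p\<close> is read as \<open>r\<close>
      and then reset to \<open>1\<close> by the multiple of the axis vector.\<close>
    define \<psi> where "\<psi> p = - (Q (fst p) (snd p $ j) (snd p + (1 - snd p $ j) *\<^sub>R axis j 1)
        + (\<Sum>i\<in>J. snd p $ i *\<^sub>R b i))" for p :: "(real^'n) \<times> (real^'n)"
    have lin: "(\<lambda>p::(real^'n) \<times> (real^'n). snd p $ i) differentiable_on UNIV" for i
      by (intro linear_imp_differentiable_on linearI) auto
    have "(\<lambda>p::(real^'n) \<times> (real^'n). (fst p, snd p $ j, snd p + (1 - snd p $ j) *\<^sub>R axis j (1::real)))
        differentiable_on UNIV"
      unfolding differentiable_on_def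
      by (intro ballI differentiable_Pair differentiable_add differentiable_scaleR differentiable_diff
          lin[unfolded differentiable_on_def, rule_format] linear_imp_differentiable
          differentiable_const linear_fst linear_snd) auto
    then have "(\<lambda>p. Q (fst p) (snd p $ j) (snd p + (1 - snd p $ j) *\<^sub>R axis j 1)) differentiable_on UNIV"
      using differentiable_on_compose[OF _ differentiable_on_subset[OF diff subset_UNIV]] by fastforce
    then have "\<psi> differentiable_on UNIV"
      unfolding \<psi>_def differentiable_on_def
      by (intro ballI differentiable_minus differentiable_add differentiable_sum
          differentiable_scaleR lin[unfolded differentiable_on_def, rule_format] differentiable_const) auto
    moreover have "DIM((real^'n) \<times> (real^'n)) < DIM('b)" using dim by simp
    ultimately have neg: "negligible (range \<psi>)"
      by (rule negligible_differentiable_image_lowdim[rotated])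
    \<comment> \<open>A nonempty open ball is not negligible, so some small vector avoids all
      forbidden values.\<close>
    have "\<not> ball 0 \<delta> \<subseteq> range \<psi>"
      using negligible_subset[OF neg, of "ball 0 \<delta>"] open_not_negligible[of "ball (0::'b) \<delta>"] \<open>\<delta> > 0\<close>
      by auto
    then obtain w where "w \<in> ball 0 \<delta>" and wr: "w \<notin> range \<psi>" by blast
    then have w: "norm w \<le> \<delta>" "w \<notin> range \<psi>" by auto
    define b' where "b' = b(j := w)"
    have sumb': "(\<Sum>i\<in>J. u $ i *\<^sub>R b' i) = (\<Sum>i\<in>J. u $ i *\<^sub>R b i)" for u :: "real^'n"
      using insert.hyps by (intro sum.cong) (auto simp: b'_def)
    have nonzero: "Q x r u + (\<Sum>i\<in>insert j J. u $ i *\<^sub>R b' i) \<noteq> 0"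
      if u: "i \<in> insert j J" "u $ i \<noteq> 0" for x r u i
    proof (cases "u $ j = 0")
      case True
      then have "i \<in> J" using u by auto
      then show ?thesis using b(2)[OF _ u(2)] True insert.hyps by (simp add: sumb')
    next
      case False
      define s where "s = u $ j"
      have s: "s \<noteq> 0" using False by (simp add: s_def)
      define y where "y = (\<chi> i. if i = j then r * s else u $ i / s)"
      have y: "y + (1 - y $ j) *\<^sub>R axis j 1 = (1 / s) *\<^sub>R u"
        using s by (auto simp: vec_eq_iff y_def axis_def s_def)
      have Qy: "s *\<^sub>R Q x (y $ j) ((1 / s) *\<^sub>R u) = Q x r u"
        using hom[OF s, of x "r * s" "(1 / s) *\<^sub>R u"] s by (simp add: y_def)
      have Sy: "s *\<^sub>R (\<Sum>i\<in>J. y $ i *\<^sub>R b i) = (\<Sum>i\<in>J. u $ i *\<^sub>R b i)"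
        unfolding scaleR_sum_right using insert.hyps s by (intro sum.cong) (auto simp: y_def)
      have "s *\<^sub>R \<psi> (x, y) = - (Q x r u + (\<Sum>i\<in>J. u $ i *\<^sub>R b i))"
        using Qy Sy by (simp add: \<psi>_def y scaleR_add_right scaleR_diff_right)
      moreover have "s *\<^sub>R w \<noteq> s *\<^sub>R \<psi> (x, y)" using w(2) s by auto
      ultimately have "s *\<^sub>R w \<noteq> - (Q x r u + (\<Sum>i\<in>J. u $ i *\<^sub>R b i))" by simp
      moreover have "(\<Sum>i\<in>insert j J. u $ i *\<^sub>R b' i) = s *\<^sub>R w + (\<Sum>i\<in>J. u $ i *\<^sub>R b i)"
        using insert.hyps by (simp add: sumb') (simp add: b'_def s_def)
      ultimately show ?thesis
        unfolding eq_neg_iff_add_eq_0 by (simp add: add_ac)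
    qed
    show ?case
    proof (intro exI[of _ b'] conjI allI impI)
      show "norm (b' i) \<le> \<delta>" for i using b(1) w(1) by (simp add: b'_def)
      fix x r and u :: "real^'n"
      assume "\<exists>i\<in>insert j J. u $ i \<noteq> 0"
      then obtain i where "i \<in> insert j J" "u $ i \<noteq> 0" ..
      then show "Q x r u + (\<Sum>i\<in>insert j J. u $ i *\<^sub>R b' i) \<noteq> 0" by (rule nonzero)
    qed
  qed
  from this[of UNIV] obtain b where b: "\<forall>j. norm (b j) \<le> \<delta>"
    "\<forall>x r u. (\<exists>j\<in>UNIV. u $ j \<noteq> 0) \<longrightarrow> Q x r u + (\<Sum>j\<in>UNIV. u $ j *\<^sub>R b j) \<noteq> 0"
    by (elim exE conjE)
  show ?thesis
  proof (rule that[OF b(1)[rule_format]])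
    fix x r and u :: "real^'n"
    assume "u \<noteq> 0"
    then have "\<exists>j\<in>UNIV. u $ j \<noteq> 0" by (auto simp: vec_eq_iff)
    then show "Q x r u + (\<Sum>j\<in>UNIV. u $ j *\<^sub>R b j) \<noteq> 0" by (rule b(2)[rule_format])
  qed
qed

text \<open>The difference quotient of \<open>G t\<close> at \<open>x\<close> with increment
  \<open>r\<close> is that of the perturbed polynomial at \<open>t x\<close> with increment
  \<open>t r\<close>. One compactness argument therefore bounds it below for all \<open>t\<close> in
  \<open>[0, 1]\<close>, including the linear map at \<open>t = 0\<close>.\<close>

lemma embedding_isotopy:
  fixes f :: "real^'n \<Rightarrow> 'b::euclidean_space"
  assumes dim: "2 * CARD('n) < DIM('b)" and f: "continuous_on UNIV f" and e: "e > 0" and R: "R \<ge> 0"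
  obtains c :: 'b and G u :: "real \<Rightarrow> real^'n \<Rightarrow> 'b" and L where
    "\<And>x. norm x \<le> R \<Longrightarrow> norm (f x - (c + G 1 x)) \<le> e"
    "linear (G 0)"
    "\<And>t x. ((\<lambda>t. G t x) has_vector_derivative u t x) (at t)"
    "continuous_on UNIV (\<lambda>(t, x). u t x)"
    "L \<ge> 0"
    "\<And>t x y. 0 \<le> t \<Longrightarrow> t \<le> 1 \<Longrightarrow> norm x \<le> R \<Longrightarrow> norm y \<le> R \<Longrightarrow>
      norm (u t x - u t y) \<le> L * norm (G t x - G t y)"
proof -
  obtain n :: nat and c a k v where F:
    "\<And>x. norm x \<le> R \<Longrightarrow> norm (f x - (c + (\<Sum>i<n. (a i \<bullet> x) ^ Suc (k i) *\<^sub>R v i))) \<le> e / 2"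
    by (rule ridge_polynomial_dense[OF f half_gt_zero[OF e], of R]) (rule that)
  \<comment> \<open>The divided difference of the power \<open>Suc p\<close>, written as a
    polynomial so that it also gives the derivative at \<open>s = s'\<close>.\<close>
  define S where "S p s s' = (\<Sum>q<Suc p. s ^ q * s' ^ (p - q))" for p and s s' :: real
  define Q where "Q x r u = (\<Sum>i<n. ((a i \<bullet> u) * S (k i) (a i \<bullet> (x + r *\<^sub>R u)) (a i \<bullet> x)) *\<^sub>R v i)" for x r u
  have diffQ: "(\<lambda>p. Q (fst p) (fst (snd p)) (snd (snd p))) differentiable_on UNIV"
    unfolding Q_def S_def differentiable_on_def
    by (intro ballI differentiable_sum finite_lessThan differentiable_scaleR differentiable_mult
        differentiable_power differentiable_inner differentiable_add differentiable_const
        linear_imp_differentiable linearI) auto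
  have homQ: "Q x (r / s) (s *\<^sub>R u) = s *\<^sub>R Q x r u" if "s \<noteq> 0" for x r s u
    using that by (simp add: Q_def scaleR_sum_right mult.assoc)
  \<comment> \<open>Makes the perturbation \<open>B\<close> at most \<open>e / 2\<close> on the
    ball: each of the \<open>CARD('n)\<close> summands is at most \<open>R * \<delta>\<close>. Using
    \<open>R + 1\<close> avoids division by zero.\<close>
  define \<delta> where "\<delta> = e / (2 * real CARD('n) * (R + 1))"
  have \<delta>: "\<delta> > 0" using e R by (simp add: \<delta>_def)
  obtain b where b: "\<And>j. norm (b j) \<le> \<delta>"
    "\<And>x r u. u \<noteq> 0 \<Longrightarrow> Q x r u + (\<Sum>j\<in>UNIV. u $ j *\<^sub>R b j) \<noteq> 0"
    by (rule linear_perturbation_nonvanishing[OF dim diffQ homQ \<delta>]) (simp, rule that)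
  define B where "B x = (\<Sum>j\<in>UNIV. x $ j *\<^sub>R b j)" for x
  have B: "linear B"
    unfolding B_def by (rule linearI) (simp_all add: scaleR_left_distrib sum.distrib scaleR_sum_right)
  have Bcont: "continuous_on X B" for X using B by (rule linear_continuous_on[OF linear_conv_bounded_linear[THEN iffD1]])
  \<comment> \<open>The perturbed polynomial at \<open>t x\<close> divided by \<open>t\<close>, with
    the division carried out termwise so that \<open>t = 0\<close> is allowed.\<close>
  define G where "G t x = B x + (\<Sum>i<n. (t ^ k i * (a i \<bullet> x) ^ Suc (k i)) *\<^sub>R v i)" for t x
  \<comment> \<open>For \<open>k i = 0\<close> the truncated exponent is harmless, since the factor
    \<open>real (k i)\<close> vanishes.\<close>
  define u where "u t x = (\<Sum>i<n. (real (k i) * t ^ (k i - 1) * (a i \<bullet> x) ^ Suc (k i)) *\<^sub>R v i)" for t x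
  have diff_pow: "s ^ Suc p - s' ^ Suc p = (s - s') * S p s s'" for s s' p
    unfolding S_def by (rule diff_power_eq_sum)
  have Sscale: "S p (t * s) (t * s') = t ^ p * S p s s'" for p t s s'
    unfolding S_def sum_distrib_left
  proof (rule sum.cong)
    fix q assume "q \<in> {..<Suc p}"
    then have "t ^ p = t ^ q * t ^ (p - q)" by (simp flip: power_add)
    then show "(t * s) ^ q * (t * s') ^ (p - q) = t ^ p * (s ^ q * s' ^ (p - q))"
      by (simp add: power_mult_distrib)
  qed simp
  have Gdiff: "G t (x + r *\<^sub>R w) - G t x = r *\<^sub>R (Q (t *\<^sub>R x) (t * r) w + B w)" for t x r w
  proof -
    have summand: "t ^ k i * (a i \<bullet> (x + r *\<^sub>R w)) ^ Suc (k i) - t ^ k i * (a i \<bullet> x) ^ Suc (k i)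
        = r * ((a i \<bullet> w) * S (k i) (a i \<bullet> (t *\<^sub>R x + (t * r) *\<^sub>R w)) (a i \<bullet> (t *\<^sub>R x)))" for i
    proof -
      have "t ^ k i * (a i \<bullet> (x + r *\<^sub>R w)) ^ Suc (k i) - t ^ k i * (a i \<bullet> x) ^ Suc (k i)
          = t ^ k i * ((r * (a i \<bullet> w)) * S (k i) (a i \<bullet> (x + r *\<^sub>R w)) (a i \<bullet> x))"
        unfolding right_diff_distrib[symmetric] diff_pow by (simp add: inner_add_right)
      also have "\<dots> = r * ((a i \<bullet> w) * S (k i) (t * (a i \<bullet> (x + r *\<^sub>R w))) (t * (a i \<bullet> x)))"
        unfolding Sscale by simp
      also have "t * (a i \<bullet> (x + r *\<^sub>R w)) = a i \<bullet> (t *\<^sub>R x + (t * r) *\<^sub>R w)"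
        by (simp add: inner_add_right algebra_simps)
      finally show ?thesis by simp
    qed
    have "G t (x + r *\<^sub>R w) - G t x = r *\<^sub>R B w + (\<Sum>i<n. (t ^ k i * (a i \<bullet> (x + r *\<^sub>R w)) ^ Suc (k i)
        - t ^ k i * (a i \<bullet> x) ^ Suc (k i)) *\<^sub>R v i)"
      by (simp add: G_def linear_add[OF B] linear_cmul[OF B] scaleR_left_diff_distrib sum_subtractf)
    then show ?thesis
      unfolding summand by (simp add: Q_def scaleR_add_right scaleR_sum_right)
  qed
  \<comment> \<open>\<open>X\<close> contains all triples \<open>(t x, t r, w)\<close> arising from
    two distinct points of the ball and \<open>t\<close> in \<open>[0, 1]\<close>. It includes
    \<open>r = 0\<close>, so positivity of the minimum \<open>c0\<close> expresses immersivity
    together with injectivity.\<close>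
  define X where "X = cball (0::real^'n) R \<times> {0..2 * R} \<times> sphere (0::real^'n) 1"
  have "compact X" unfolding X_def by (intro compact_Times compact_cball compact_sphere compact_Icc)
  moreover have "X \<noteq> {}"
  proof -
    have "(0, 0, axis undefined 1) \<in> X" using R by (simp add: X_def)
    then show ?thesis by blast
  qed
  moreover have "continuous_on X (\<lambda>(x, r, w). norm (Q x r w + B w))"
    unfolding Q_def S_def case_prod_beta
    by (intro continuous_intros continuous_on_compose2[OF Bcont[of UNIV]]) auto
  ultimately have "\<exists>p\<in>X. \<forall>q\<in>X.
      (\<lambda>(x, r, w). norm (Q x r w + B w)) p \<le> (\<lambda>(x, r, w). norm (Q x r w + B w)) q"
    by (rule continuous_attains_inf)
  then obtain p where p: "p \<in> X" "\<forall>q\<in>X.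
      (\<lambda>(x, r, w). norm (Q x r w + B w)) p \<le> (\<lambda>(x, r, w). norm (Q x r w + B w)) q"
    by (elim bexE)
  define c0 where "c0 = (\<lambda>(x, r, w). norm (Q x r w + B w)) p"
  have c0: "c0 > 0"
  proof -
    obtain x r w where p_eq: "p = (x, r, w)" by (cases p)
    then have "w \<noteq> 0" using p(1) by (auto simp: X_def)
    then show ?thesis using b(2)[of w x r] by (simp add: c0_def p_eq B_def)
  qed
  have lower: "c0 * norm (y - x) \<le> norm (G t y - G t x)"
    if t: "0 \<le> t" "t \<le> 1" and x: "norm x \<le> R" and y: "norm y \<le> R" for t x y
  proof (cases "x = y")
    case True
    then show ?thesis by simp
  next
    case False
    define r where "r = norm (y - x)"
    define w where "w = (1 / r) *\<^sub>R (y - x)"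
    have r: "r > 0" "r \<le> 2 * R" using False norm_triangle_ineq4[of y x] x y by (auto simp: r_def)
    have w: "norm w = 1" "y = x + r *\<^sub>R w" using r by (auto simp: w_def r_def)
    have "norm (t *\<^sub>R x) \<le> 1 * R" unfolding norm_scaleR using t x by (intro mult_mono) auto
    moreover have "t * r \<le> 1 * (2 * R)" using t r by (intro mult_mono) auto
    ultimately have "(t *\<^sub>R x, t * r, w) \<in> X" using t r w by (simp add: X_def)
    from p(2)[rule_format, OF this] have "c0 \<le> norm (Q (t *\<^sub>R x) (t * r) w + B w)" by (simp add: c0_def)
    then have "c0 * r \<le> norm (Q (t *\<^sub>R x) (t * r) w + B w) * r" using r by (intro mult_right_mono) auto
    also have "\<dots> = norm (G t y - G t x)" unfolding w(2) Gdiff using r by simp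
    finally show ?thesis by (simp add: r_def)
  qed
  have Sbound: "\<bar>S p s s'\<bar> \<le> real (Suc p) * m ^ p" if "\<bar>s\<bar> \<le> m" "\<bar>s'\<bar> \<le> m" for p s s' m
  proof -
    have "\<bar>s ^ q * s' ^ (p - q)\<bar> \<le> m ^ p" if "q < Suc p" for q
    proof -
      have "\<bar>s ^ q * s' ^ (p - q)\<bar> \<le> m ^ q * m ^ (p - q)"
        unfolding abs_mult power_abs using \<open>\<bar>s\<bar> \<le> m\<close> \<open>\<bar>s'\<bar> \<le> m\<close> by (intro mult_mono power_mono) auto
      then show ?thesis using that by (simp flip: power_add)
    qed
    then have "(\<Sum>q<Suc p. \<bar>s ^ q * s' ^ (p - q)\<bar>) \<le> (\<Sum>q<Suc p. m ^ p)"
      by (intro sum_mono) auto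
    then show ?thesis unfolding S_def by (intro order_trans[OF sum_abs]) simp
  qed
  define C where "C = (\<Sum>i<n. real (k i) * (norm (a i) * (real (Suc (k i)) * (norm (a i) * R) ^ k i)) * norm (v i))"
  have C: "C \<ge> 0" unfolding C_def using R by (intro sum_nonneg) auto
  have upper: "norm (u t x - u t y) \<le> C * norm (x - y)"
    if t: "0 \<le> t" "t \<le> 1" and x: "norm x \<le> R" and y: "norm y \<le> R" for t x y
  proof -
    have "u t x - u t y = (\<Sum>i<n. (real (k i) * t ^ (k i - 1) * ((a i \<bullet> x) ^ Suc (k i) - (a i \<bullet> y) ^ Suc (k i))) *\<^sub>R v i)"
      by (simp add: u_def right_diff_distrib scaleR_left_diff_distrib sum_subtractf)
    also have "norm \<dots> \<le> (\<Sum>i<n. real (k i) * (norm (a i) * (real (Suc (k i)) * (norm (a i) * R) ^ k i)) * norm (v i) * norm (x - y))"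
    proof (rule order_trans[OF norm_sum], rule sum_mono)
      fix i
      have ax: "\<bar>a i \<bullet> x\<bar> \<le> norm (a i) * R" and ay: "\<bar>a i \<bullet> y\<bar> \<le> norm (a i) * R"
        using Cauchy_Schwarz_ineq2[of "a i" x] Cauchy_Schwarz_ineq2[of "a i" y] x y
        by (meson mult_left_mono norm_ge_zero order_trans)+
      have "\<bar>a i \<bullet> x - a i \<bullet> y\<bar> \<le> norm (a i) * norm (x - y)"
        using Cauchy_Schwarz_ineq2[of "a i" "x - y"] by (simp add: inner_diff_right)
      then have "\<bar>(a i \<bullet> x) ^ Suc (k i) - (a i \<bullet> y) ^ Suc (k i)\<bar>
          \<le> (norm (a i) * norm (x - y)) * (real (Suc (k i)) * (norm (a i) * R) ^ k i)"
        unfolding diff_pow abs_mult using Sbound[OF ax ay] by (intro mult_mono) auto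
      moreover have "\<bar>real (k i) * t ^ (k i - 1)\<bar> \<le> real (k i)"
        using t by (simp add: abs_mult power_le_one mult_left_le)
      ultimately have "\<bar>real (k i) * t ^ (k i - 1) * ((a i \<bullet> x) ^ Suc (k i) - (a i \<bullet> y) ^ Suc (k i))\<bar>
          \<le> real (k i) * ((norm (a i) * norm (x - y)) * (real (Suc (k i)) * (norm (a i) * R) ^ k i))"
        unfolding abs_mult[of "real (k i) * t ^ (k i - 1)"] by (intro mult_mono) auto
      from mult_right_mono[OF this norm_ge_zero[of "v i"]]
      show "norm ((real (k i) * t ^ (k i - 1) * ((a i \<bullet> x) ^ Suc (k i) - (a i \<bullet> y) ^ Suc (k i))) *\<^sub>R v i)
        \<le> real (k i) * (norm (a i) * (real (Suc (k i)) * (norm (a i) * R) ^ k i)) * norm (v i) * norm (x - y)"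
        by (simp add: mult_ac)
    qed
    finally show ?thesis by (simp add: C_def sum_distrib_right)
  qed
  show ?thesis
  \<comment> \<open>Dividing the Lipschitz constant of \<open>u t\<close> by the lower bound for the
    expansion of \<open>G t\<close> controls velocities by distances in the target space.\<close>
  proof (rule that[of c G u "C / c0"])
    fix x :: "real^'n" assume x: "norm x \<le> R"
    have "norm (B x) \<le> (\<Sum>j\<in>(UNIV::'n set). R * \<delta>)"
      unfolding B_def
    proof (rule order_trans[OF norm_sum], rule sum_mono)
      fix j
      show "norm (x $ j *\<^sub>R b j) \<le> R * \<delta>"
        unfolding norm_scaleR using component_le_norm_cart[of x j] x b(1)[of j] R by (intro mult_mono) auto
    qed
    also have "\<dots> \<le> real CARD('n) * ((R + 1) * \<delta>)" using \<delta> by simp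
    also have "\<dots> = e / 2" using R by (simp add: \<delta>_def)
    finally have Bx: "norm (B x) \<le> e / 2" .
    have "f x - (c + G 1 x) = (f x - (c + (\<Sum>i<n. (a i \<bullet> x) ^ Suc (k i) *\<^sub>R v i))) - B x"
      by (simp add: G_def)
    also have "norm \<dots> \<le> e / 2 + e / 2"
      by (rule norm_triangle_le_diff, rule add_mono[OF F[OF x] Bx])
    finally show "norm (f x - (c + G 1 x)) \<le> e" by simp
  next
    have "linear (\<lambda>x. (0 ^ k i * (a i \<bullet> x) ^ Suc (k i)) *\<^sub>R v i)" for i
      by (cases "k i") (auto intro!: linearI simp: inner_add_right scaleR_left_distrib)
    then show "linear (G 0)" unfolding G_def[abs_def] by (intro linear_compose_add[OF B] linear_compose_sum) auto
  next
    show "((\<lambda>t. G t x) has_vector_derivative u t x) (at t)" for t x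
    proof -
      have "((\<lambda>t. (t ^ k i * (a i \<bullet> x) ^ Suc (k i)) *\<^sub>R v i) has_vector_derivative
          (real (k i) * t ^ (k i - 1) * (a i \<bullet> x) ^ Suc (k i)) *\<^sub>R v i) (at t)" for i
        by (auto intro!: derivative_eq_intros simp: has_vector_derivative_def fun_eq_iff)
      then have "((\<lambda>t. \<Sum>i<n. (t ^ k i * (a i \<bullet> x) ^ Suc (k i)) *\<^sub>R v i) has_vector_derivative u t x) (at t)"
        unfolding u_def by (intro has_vector_derivative_sum)
      from has_vector_derivative_add[OF has_vector_derivative_const[of "B x"] this]
      show ?thesis by (simp add: G_def[abs_def])
    qed
  next
    show "continuous_on UNIV (\<lambda>(t, x). u t x)"
      unfolding u_def case_prod_beta by (intro continuous_intros)
  next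
    show "C / c0 \<ge> 0" using C c0 by simp
  next
    fix t :: real and x y :: "real^'n"
    assume "0 \<le> t" "t \<le> 1" "norm x \<le> R" "norm y \<le> R"
    note * = upper[OF this] lower[OF this(1,2,4,3)]
    have "C * norm (x - y) = C / c0 * (c0 * norm (x - y))" using c0 by simp
    also have "\<dots> \<le> C / c0 * norm (G t x - G t y)" using *(2) C c0 by (intro mult_left_mono) auto
    finally show "norm (u t x - u t y) \<le> C / c0 * norm (G t x - G t y)" using *(1) by simp
  qed
qed

subsection \<open>Networks\<close>

text \<open>Consecutive affine maps merge into one, so composing networks with affine maps costs no
  layer.\<close>

lemma affine_sum_compose:
  fixes c0 :: real
  assumes "finite J"
  shows "(\<Sum>l\<in>L. M l * ((\<Sum>j\<in>J. A l j * y j) + c l)) + c0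
    = (\<Sum>j\<in>J. (\<Sum>l\<in>L. M l * A l j) * y j) + ((\<Sum>l\<in>L. M l * c l) + c0)"
proof -
  have "(\<Sum>l\<in>L. M l * (\<Sum>j\<in>J. A l j * y j)) = (\<Sum>l\<in>L. \<Sum>j\<in>J. M l * A l j * y j)"
    by (simp add: sum_distrib_left mult.assoc)
  also have "\<dots> = (\<Sum>j\<in>J. (\<Sum>l\<in>L. M l * A l j) * y j)"
    by (subst sum.swap) (simp add: sum_distrib_right)
  finally show ?thesis by (simp add: distrib_left sum.distrib)
qed

lemma NN_affineI: "(\<lambda>x. \<chi> k. (\<Sum>j\<in>UNIV. A k j * x $ j) + c k) \<in> NN S w"
  unfolding NN_def by blast

lemma NN_hidI: "hid S w d h \<Longrightarrow> (\<lambda>x. \<chi> k. (\<Sum>j<d. B k j * h x j) + c k) \<in> NN S w"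
  unfolding NN_def by blast

lemma NN_affine:
  assumes "linear P"
  shows "(\<lambda>x. P x + c) \<in> NN S w"
proof -
  have "(\<lambda>x. P x + c) = (\<lambda>x. \<chi> k. (\<Sum>j\<in>UNIV. matrix P $ k $ j * x $ j) + c $ k)"
  proof
    fix x
    have "P x = matrix P *v x" by (rule fun_cong[OF matrix_vector_mul(2)[OF assms], symmetric])
    then show "P x + c = (\<chi> k. (\<Sum>j\<in>UNIV. matrix P $ k $ j * x $ j) + c $ k)"
      by (simp add: vec_eq_iff matrix_vector_mult_def)
  qed
  then show ?thesis by (simp only: NN_affineI)
qed

lemma NN_affine_image:
  fixes g :: "real^'n \<Rightarrow> real^'a" and P :: "real^'a \<Rightarrow> real^'b"
  assumes g: "g \<in> NN S w" and P: "linear P"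
  shows "(\<lambda>x. P (g x) + c) \<in> NN S w"
proof -
  define M where "M = matrix P"
  have Pg: "P y + c = (\<chi> k. (\<Sum>l\<in>UNIV. M $ k $ l * y $ l) + c $ k)" for y
    using fun_cong[OF matrix_vector_mul(2)[OF P], of y] by (simp add: vec_eq_iff matrix_vector_mult_def M_def)
  from g consider A c' where "g = (\<lambda>x. \<chi> k. (\<Sum>j\<in>UNIV. A k j * x $ j) + c' k)"
    | d h B c' where "hid S w d h" "g = (\<lambda>x. \<chi> k. (\<Sum>j<d. B k j * h x j) + c' k)"
    unfolding NN_def by blast
  then show ?thesis
  proof cases
    case (1 A c')
    have "(\<lambda>x. P (g x) + c) = (\<lambda>x. \<chi> k. (\<Sum>j\<in>UNIV. (\<Sum>l\<in>UNIV. M $ k $ l * A l j) * x $ j)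
        + ((\<Sum>l\<in>UNIV. M $ k $ l * c' l) + c $ k))"
      unfolding Pg 1 by (simp add: affine_sum_compose)
    then show ?thesis by (simp only: NN_affineI)
  next
    case (2 d h B c')
    have "(\<lambda>x. P (g x) + c) = (\<lambda>x. \<chi> k. (\<Sum>j<d. (\<Sum>l\<in>UNIV. M $ k $ l * B l j) * h x j)
        + ((\<Sum>l\<in>UNIV. M $ k $ l * c' l) + c $ k))"
      unfolding Pg 2 by (simp add: affine_sum_compose)
    then show ?thesis by (simp only: NN_hidI[OF 2(1)])
  qed
qed

text \<open>The output map of \<open>g\<close> is absorbed into the next affine map, so the output
  dimension of \<open>g\<close> does not count towards the width.\<close>

lemma hid_layer:
  fixes g :: "real^'n \<Rightarrow> real^'a"
  assumes g: "g \<in> NN S w" and d: "1 \<le> d" "d \<le> w" and \<rho>: "\<rho> \<in> S"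
  shows "hid S w d (\<lambda>x i. \<rho> ((\<Sum>l\<in>UNIV. q i l * g x $ l) + b i))"
proof -
  from g consider A c where "g = (\<lambda>x. \<chi> k. (\<Sum>j\<in>UNIV. A k j * x $ j) + c k)"
    | d' h B c where "hid S w d' h" "g = (\<lambda>x. \<chi> k. (\<Sum>j<d'. B k j * h x j) + c k)"
    unfolding NN_def by blast
  then show ?thesis
  proof cases
    case (1 A c)
    show ?thesis
      using hid.first[OF d \<rho>, of "\<lambda>i j. \<Sum>l\<in>UNIV. q i l * A l j" "\<lambda>i. (\<Sum>l\<in>UNIV. q i l * c l) + b i"]
      unfolding 1 by (simp add: affine_sum_compose)
  next
    case (2 d' h B c)
    show ?thesis
      using hid.step[OF 2(1) d \<rho>, of "\<lambda>i j. \<Sum>l\<in>UNIV. q i l * B l j" "\<lambda>i. (\<Sum>l\<in>UNIV. q i l * c l) + b i"]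
      unfolding 2(2) by (simp add: affine_sum_compose)
  qed
qed

text \<open>Neurons are indexed by a finite type, so that coordinates, or coordinates with one extra
  element, can label them directly; \<open>e\<close> translates to numerical indices.\<close>

lemma NN_layer:
  fixes g :: "real^'n \<Rightarrow> real^'a" and q :: "'k::finite \<Rightarrow> real^'a" and p :: "'k \<Rightarrow> real^'b"
  assumes g: "g \<in> NN S w" and \<rho>: "\<rho> \<in> S" and w: "CARD('k) \<le> w"
  shows "(\<lambda>x. (\<Sum>i\<in>UNIV. \<rho> (q i \<bullet> g x + b i) *\<^sub>R p i) + c) \<in> NN S w"
proof -
  obtain e where e: "bij_betw e {..<CARD('k)} (UNIV :: 'k set)"
    using ex_bij_betw_nat_finite[of "UNIV :: 'k set"] by (auto simp: atLeast0LessThan)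
  have h: "hid S w CARD('k) (\<lambda>x i. \<rho> ((\<Sum>l\<in>UNIV. q (e i) $ l * g x $ l) + b (e i)))"
    by (rule hid_layer[OF g _ w \<rho>]) (simp add: Suc_leI)
  have "(\<Sum>i\<in>UNIV. \<rho> (q i \<bullet> g x + b i) *\<^sub>R p i) + c
      = (\<chi> k. (\<Sum>j<CARD('k). p (e j) $ k * \<rho> ((\<Sum>l\<in>UNIV. q (e j) $ l * g x $ l) + b (e j))) + c $ k)" for x
  proof -
    have "(\<Sum>i\<in>UNIV. \<rho> (q i \<bullet> g x + b i) *\<^sub>R p i) $ k
        = (\<Sum>j<CARD('k). p (e j) $ k * \<rho> ((\<Sum>l\<in>UNIV. q (e j) $ l * g x $ l) + b (e j)))" for k
      unfolding sum_component
      by (subst sum.reindex_bij_betw[OF e, symmetric]) (simp add: inner_vec_def mult.commute)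
    then show ?thesis by (simp add: vec_eq_iff)
  qed
  then have "(\<lambda>x. (\<Sum>i\<in>UNIV. \<rho> (q i \<bullet> g x + b i) *\<^sub>R p i) + c)
      = (\<lambda>x. \<chi> k. (\<Sum>j<CARD('k). p (e j) $ k * \<rho> ((\<Sum>l\<in>UNIV. q (e j) $ l * g x $ l) + b (e j))) + c $ k)"
    by blast
  then show ?thesis by (simp only: NN_hidI[OF h])
qed

section \<open>Maps that preserve approximability by networks\<close>

text \<open>Boundedness is included because a continuous map applied afterwards is uniformly
  continuous only on bounded sets.\<close>

definition approx_on :: "(real \<Rightarrow> real) set \<Rightarrow> nat \<Rightarrow> (real^'n) set \<Rightarrow> (real^'n \<Rightarrow> real^'w) \<Rightarrow> bool" where
  "approx_on S w K f \<longleftrightarrow> bounded (f ` K) \<and> (\<forall>e>0. \<exists>g\<in>NN S w. \<forall>x\<in>K. norm (f x - g x) \<le> e)"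

text \<open>Shears are realised only approximately by networks. Defining the class by its action on
  approximable maps makes closure under composition immediate.\<close>

definition approx_preserving :: "(real \<Rightarrow> real) set \<Rightarrow> nat \<Rightarrow> (real^'n) set \<Rightarrow> (real^'w \<Rightarrow> real^'w) set" where
  "approx_preserving S w K = {\<Phi>. \<forall>f. approx_on S w K f \<longrightarrow> approx_on S w K (\<lambda>x. \<Phi> (f x))}"

lemma approx_onE:
  assumes "approx_on S w K f" "e > 0"
  obtains g where "g \<in> NN S w" "\<And>x. x \<in> K \<Longrightarrow> norm (f x - g x) \<le> e"
  using assms unfolding approx_on_def by auto

lemma map_monoid_approx_preserving: "map_monoid (approx_preserving S w K)"
  by unfold_locales (auto simp: approx_preserving_def)

text \<open>With \<open>g\<close> close to \<open>f\<close>, the error splits at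
  \<open>\<Phi> (g x)\<close>: uniform continuity of \<open>\<Phi>\<close> handles one half and
  \<open>\<Psi>\<close> the other. The radius \<open>R + 1\<close> leaves room for
  \<open>g\<close>.\<close>

lemma layer_approx_preserving:
  fixes \<Phi> :: "real^'w \<Rightarrow> real^'w" and K :: "(real^'n) set"
  assumes cont: "continuous_on UNIV \<Phi>"
    and layer: "\<And>R e. e > 0 \<Longrightarrow> \<exists>\<Psi>. (\<forall>g. g \<in> NN S w \<longrightarrow> (\<lambda>x::real^'n. \<Psi> (g x)) \<in> NN S w) \<and>
      (\<forall>z. norm z \<le> R \<longrightarrow> norm (\<Phi> z - \<Psi> z) \<le> e)"
  shows "\<Phi> \<in> approx_preserving S w K"
  unfolding approx_preserving_def
proof (intro CollectI allI impI)
  fix f :: "real^'n \<Rightarrow> real^'w"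
  assume f: "approx_on S w K f"
  obtain R where R: "\<And>x. x \<in> K \<Longrightarrow> norm (f x) \<le> R"
    using f unfolding approx_on_def bounded_iff by (metis imageI)
  show "approx_on S w K (\<lambda>x. \<Phi> (f x))"
    unfolding approx_on_def
  proof (intro conjI allI impI)
    have "bounded (\<Phi> ` cball 0 R)"
      by (intro compact_imp_bounded compact_continuous_image continuous_on_subset[OF cont]) auto
    then show "bounded ((\<lambda>x. \<Phi> (f x)) ` K)" by (rule bounded_subset) (use R in auto)
  next
    fix e :: real assume "e > 0"
    then have e2: "e / 2 > 0" by simp
    obtain \<Psi> where \<Psi>: "\<And>g. g \<in> NN S w \<Longrightarrow> (\<lambda>x::real^'n. \<Psi> (g x)) \<in> NN S w"
      "\<And>z. norm z \<le> R + 1 \<Longrightarrow> norm (\<Phi> z - \<Psi> z) \<le> e / 2"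
      using layer[OF e2, of "R + 1"] by auto
    obtain d where d: "d > 0" "\<And>x y. norm x \<le> R + 1 \<Longrightarrow> norm y \<le> R + 1 \<Longrightarrow> dist x y < d \<Longrightarrow> dist (\<Phi> x) (\<Phi> y) < e / 2"
      using uniform_delta_cball[OF cont e2] by blast
    have "min (d / 2) 1 > 0" using d(1) by simp
    then obtain g where g: "g \<in> NN S w" "\<And>x. x \<in> K \<Longrightarrow> norm (f x - g x) \<le> min (d / 2) 1"
      using approx_onE[OF f] by blast
    have "norm (\<Phi> (f x) - \<Psi> (g x)) \<le> e" if x: "x \<in> K" for x
    proof -
      have "norm (g x) \<le> R + 1"
        using norm_triangle_sub[of "g x" "f x"] g(2)[OF x] R[OF x] by (simp add: norm_minus_commute)
      moreover have "dist (f x) (g x) < d" using g(2)[OF x] d(1) by (simp add: dist_norm)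
      ultimately have "norm (\<Phi> (f x) - \<Phi> (g x)) \<le> e / 2" "norm (\<Phi> (g x) - \<Psi> (g x)) \<le> e / 2"
        using d(2)[of "f x" "g x"] R[OF x] \<Psi>(2)[of "g x"] by (auto simp: dist_norm)
      from norm_diff_triangle_le[OF this] show ?thesis by simp
    qed
    then show "\<exists>g\<in>NN S w. \<forall>x\<in>K. norm (\<Phi> (f x) - g x) \<le> e"
      by (intro bexI[OF _ \<Psi>(1)[OF g(1)]] ballI)
  qed
qed

section \<open>Shears realised by one hidden layer\<close>

lemma continuous_on_shear:
  assumes "continuous_on UNIV \<sigma>"
  shows "continuous_on UNIV (\<lambda>z. z + \<sigma> (a \<bullet> z + b) *\<^sub>R v)"
  by (intro continuous_intros continuous_on_compose2[OF assms]) auto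

text \<open>Near \<open>\<alpha>\<close> the activation is almost affine with slope
  \<open>D\<close>, so one rescaled neuron per coordinate approximates the identity; one further
  neuron computes the ridge function.\<close>

lemma shear_preserving_smooth_point:
  fixes a v :: "real^'w" and K :: "(real^'n) set"
  assumes cont: "continuous_on UNIV \<sigma>" and der: "(\<sigma> has_real_derivative D) (at \<alpha>)" and "D \<noteq> 0"
    and w: "CARD('w) + 1 \<le> w"
  shows "(\<lambda>z. z + \<sigma> (a \<bullet> z + b) *\<^sub>R v) \<in> approx_preserving {\<sigma>} w K"
proof (rule layer_approx_preserving[OF continuous_on_shear[OF cont]])
  fix R e :: real
  assume "e > 0"
  define R' where "R' = max R 1"
  \<comment> \<open>After division by \<open>\<delta> * \<bar>D\<bar>\<close> this leaves error
    \<open>e / CARD('w)\<close> per coordinate, and the sum over coordinates bounds the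
    norm.\<close>
  define e' where "e' = e * \<bar>D\<bar> / (real CARD('w) * R')"
  have R': "R' > 0" "R \<le> R'" by (auto simp: R'_def)
  have e': "e' > 0" using \<open>e > 0\<close> \<open>D \<noteq> 0\<close> R' by (simp add: e'_def)
  have "\<exists>d>0. \<forall>y. norm (y - \<alpha>) < d \<longrightarrow> norm (\<sigma> y - \<sigma> \<alpha> - D * (y - \<alpha>)) \<le> e' * norm (y - \<alpha>)"
    using der e' unfolding has_field_derivative_def has_derivative_at_alt by blast
  then obtain d where d: "d > 0"
    "\<forall>y. norm (y - \<alpha>) < d \<longrightarrow> norm (\<sigma> y - \<sigma> \<alpha> - D * (y - \<alpha>)) \<le> e' * norm (y - \<alpha>)"
    by (elim exE conjE)
  define \<delta> where "\<delta> = d / (2 * R')"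
  have \<delta>: "\<delta> > 0" "\<delta> * R' < d" using d(1) R' by (auto simp: \<delta>_def)
  \<comment> \<open>\<open>None\<close> labels the neuron for the ridge function,
    \<open>Some i\<close> the one that carries coordinate \<open>i\<close>.\<close>
  define q where "q i = (case i of None \<Rightarrow> a | Some i \<Rightarrow> \<delta> *\<^sub>R axis i 1)" for i
  define b' where "b' i = (case i of None \<Rightarrow> b | Some i \<Rightarrow> \<alpha>)" for i :: "'w option"
  define p where "p i = (case i of None \<Rightarrow> v | Some i \<Rightarrow> (1 / (\<delta> * D)) *\<^sub>R axis i 1)" for i
  define c :: "real^'w" where "c = (\<chi> i. - \<sigma> \<alpha> / (\<delta> * D))"
  define \<Psi> where "\<Psi> z = (\<Sum>i\<in>UNIV. \<sigma> (q i \<bullet> z + b' i) *\<^sub>R p i) + c" for z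
  have \<Psi>: "\<Psi> z = (\<chi> i. (\<sigma> (\<alpha> + \<delta> * z $ i) - \<sigma> \<alpha>) / (\<delta> * D)) + \<sigma> (a \<bullet> z + b) *\<^sub>R v" for z
  proof -
    have "(\<Sum>i\<in>UNIV. \<sigma> (q i \<bullet> z + b' i) *\<^sub>R p i)
        = \<sigma> (a \<bullet> z + b) *\<^sub>R v + (\<Sum>i\<in>UNIV. \<sigma> (\<delta> * z $ i + \<alpha>) *\<^sub>R (1 / (\<delta> * D)) *\<^sub>R axis i 1)"
      by (simp add: UNIV_option_conv sum.reindex q_def b'_def p_def inner_axis')
    moreover have "(\<Sum>i\<in>UNIV. \<sigma> (\<delta> * z $ i + \<alpha>) *\<^sub>R (1 / (\<delta> * D)) *\<^sub>R (axis i 1 :: real^'w)) $ j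
        = \<sigma> (\<delta> * z $ j + \<alpha>) / (\<delta> * D)" for j
      by (simp add: axis_def if_distrib cong: if_cong)
    ultimately show ?thesis
      by (simp add: \<Psi>_def vec_eq_iff c_def diff_divide_distrib add.commute)
  qed
  have "(\<lambda>x. \<Psi> (g x)) \<in> NN {\<sigma>} w" if "g \<in> NN {\<sigma>} w" for g :: "real^'n \<Rightarrow> real^'w"
    unfolding \<Psi>_def by (rule NN_layer[OF that]) (use w in auto)
  moreover have "norm (z + \<sigma> (a \<bullet> z + b) *\<^sub>R v - \<Psi> z) \<le> e" if z: "norm z \<le> R" for z
  proof -
    have "\<bar>z $ i - (\<sigma> (\<alpha> + \<delta> * z $ i) - \<sigma> \<alpha>) / (\<delta> * D)\<bar> \<le> e / CARD('w)" for i
    proof -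
      define s where "s = z $ i"
      have s: "\<bar>s\<bar> \<le> R'" using component_le_norm_cart[of z i] z R' by (simp add: s_def)
      have "\<bar>\<delta> * s\<bar> \<le> \<delta> * R'" using s \<delta> by (simp add: abs_mult)
      then have "\<bar>\<sigma> (\<alpha> + \<delta> * s) - \<sigma> \<alpha> - D * (\<delta> * s)\<bar> \<le> e' * \<bar>\<delta> * s\<bar>"
        using d(2)[rule_format, of "\<alpha> + \<delta> * s"] \<delta> by simp
      also have "\<dots> \<le> e' * (\<delta> * R')" using \<open>\<bar>\<delta> * s\<bar> \<le> \<delta> * R'\<close> e' by (intro mult_left_mono) auto
      also have "\<dots> = (e / CARD('w)) * (\<delta> * \<bar>D\<bar>)" using R' by (simp add: e'_def)
      finally have "\<bar>\<sigma> (\<alpha> + \<delta> * s) - \<sigma> \<alpha> - D * (\<delta> * s)\<bar> / (\<delta> * \<bar>D\<bar>) \<le> e / CARD('w)"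
        using \<delta> \<open>D \<noteq> 0\<close> by (simp add: pos_divide_le_eq)
      moreover have "\<bar>s - (\<sigma> (\<alpha> + \<delta> * s) - \<sigma> \<alpha>) / (\<delta> * D)\<bar> = \<bar>\<sigma> (\<alpha> + \<delta> * s) - \<sigma> \<alpha> - D * (\<delta> * s)\<bar> / (\<delta> * \<bar>D\<bar>)"
      proof -
        have "s - (\<sigma> (\<alpha> + \<delta> * s) - \<sigma> \<alpha>) / (\<delta> * D) = - ((\<sigma> (\<alpha> + \<delta> * s) - \<sigma> \<alpha> - D * (\<delta> * s)) / (\<delta> * D))"
          using \<delta> \<open>D \<noteq> 0\<close> by (simp add: field_simps)
        then show ?thesis using \<delta> by (simp add: abs_mult)
      qed
      ultimately show ?thesis by (simp add: s_def)
    qed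
    then have "(\<Sum>i\<in>UNIV. \<bar>(z + \<sigma> (a \<bullet> z + b) *\<^sub>R v - \<Psi> z) $ i\<bar>) \<le> (\<Sum>i\<in>(UNIV::'w set). e / CARD('w))"
      by (intro sum_mono) (simp add: \<Psi>)
    then show ?thesis using norm_le_l1_cart[of "z + \<sigma> (a \<bullet> z + b) *\<^sub>R v - \<Psi> z"] by simp
  qed
  ultimately show "\<exists>\<Psi>. (\<forall>g. g \<in> NN {\<sigma>} w \<longrightarrow> (\<lambda>x::real^'n. \<Psi> (g x)) \<in> NN {\<sigma>} w) \<and>
      (\<forall>z. norm z \<le> R \<longrightarrow> norm (z + \<sigma> (a \<bullet> z + b) *\<^sub>R v - \<Psi> z) \<le> e)"
    by (intro exI[of _ \<Psi>] conjI allI impI)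
qed

lemma continuous_on_relu: "continuous_on X relu"
  unfolding relu_def by (intro continuous_intros)

lemma relu_not_poly: "\<not> (\<exists>p. \<forall>x. relu x = poly p x)"
proof
  assume "\<exists>p. \<forall>x. relu x = poly p x"
  then obtain p where p: "\<And>x. relu x = poly p x" by blast
  have "{..0::real} \<subseteq> {x. poly p x = 0}" by (auto simp: relu_def simp flip: p)
  then have "p = 0" using poly_roots_finite[of p] finite_subset infinite_Iic by blast
  then show False using p[of 1] by (simp add: relu_def)
qed

lemma relu_lipschitz: "\<bar>relu s - relu t\<bar> \<le> \<bar>s - t\<bar>"
  by (simp add: relu_def max_def)

text \<open>In the coordinates \<open>a \<bullet> z + b\<close> and \<open>z $ i - (v $ i / v $ j) z $ j\<close> for \<open>i \<noteq> j\<close>, the shear only changes the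
  first one, by \<open>s \<mapsto> s + (a \<bullet> v) ReLU s\<close>, a multiple of a Leaky-ReLU. The offset \<open>C\<close> keeps the other
  coordinates in the range where the activation is the identity.\<close>

lemma lrelu_layer:
  fixes a v z :: "real^'w"
  assumes m: "a \<bullet> v \<noteq> 0" "a \<bullet> v \<noteq> -1" and j: "v $ j \<noteq> 0"
  obtains \<beta> q b' p c where "\<And>z. norm z \<le> R \<Longrightarrow>
    z + relu (a \<bullet> z + b) *\<^sub>R v = (\<Sum>i\<in>(UNIV::'w set). lrelu \<beta> (q i \<bullet> z + b' i) *\<^sub>R p i) + c"
proof -
  define m where "m = a \<bullet> v"
  have m0: "m \<noteq> 0" "1 + m \<noteq> 0" using m by (auto simp: m_def)
  define C where "C = (1 + (\<Sum>i\<in>UNIV. \<bar>v $ i / v $ j\<bar>)) * R"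
  define q where "q i = (if i = j then a else axis i 1 - (v $ i / v $ j) *\<^sub>R axis j 1)" for i
  define b' where "b' i = (if i = j then b else C)" for i
  \<comment> \<open>The basis dual to the functionals \<open>q\<close>, except that the vector at
    \<open>j\<close> carries the factor \<open>1 + m\<close>, which turns the activation there into
    \<open>s + m * relu s\<close>.\<close>
  define p where "p i = (if i = j then ((1 + m) / m) *\<^sub>R v else axis i 1 - (a $ i / m) *\<^sub>R v)" for i
  define c where "c = - (b / m) *\<^sub>R v - (\<Sum>i\<in>UNIV - {j}. C *\<^sub>R p i)"
  have "z + relu (a \<bullet> z + b) *\<^sub>R v = (\<Sum>i\<in>UNIV. lrelu (1 / (1 + m)) (q i \<bullet> z + b' i) *\<^sub>R p i) + c"
    if z: "norm z \<le> R" for z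
  proof -
    define t where "t = z $ j / v $ j"
    define y where "y i = z $ i - t * v $ i" for i
    have qy: "q i \<bullet> z = y i" if "i \<noteq> j" for i
      using that by (simp add: q_def y_def t_def inner_diff_left inner_axis')
    have zy: "z = (\<Sum>i\<in>UNIV - {j}. y i *\<^sub>R axis i 1) + t *\<^sub>R v"
    proof -
      have "(\<Sum>i\<in>UNIV - {j}. y i *\<^sub>R (axis i 1 :: real^'w)) $ k = (if k = j then 0 else y k)" for k
        by (simp add: axis_def if_distrib cong: if_cong)
      then show ?thesis using j by (auto simp: vec_eq_iff y_def t_def)
    qed
    have az: "a \<bullet> z = (\<Sum>i\<in>UNIV - {j}. y i * a $ i) + t * m"
      by (subst zy) (simp add: inner_add_right inner_sum_right inner_axis m_def)
    have lin: "lrelu (1 / (1 + m)) (y i + C) = y i + C" if "i \<noteq> j" for i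
    proof -
      have "\<bar>y i\<bar> \<le> \<bar>z $ i\<bar> + \<bar>v $ i / v $ j\<bar> * \<bar>z $ j\<bar>"
        using abs_triangle_ineq4[of "z $ i" "t * v $ i"] by (simp add: y_def t_def abs_mult mult.commute)
      also have "\<dots> \<le> R + (\<Sum>i\<in>UNIV. \<bar>v $ i / v $ j\<bar>) * R"
      proof (intro add_mono mult_mono)
        show "\<bar>z $ i\<bar> \<le> R" "\<bar>z $ j\<bar> \<le> R" using component_le_norm_cart z order_trans by blast+
        show "\<bar>v $ i / v $ j\<bar> \<le> (\<Sum>i\<in>UNIV. \<bar>v $ i / v $ j\<bar>)" by (rule member_le_sum) auto
      qed (auto intro: sum_nonneg)
      also have "\<dots> = C" by (simp add: C_def algebra_simps)
      finally have "0 \<le> y i + C" by linarith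
      then show ?thesis by (simp add: lrelu_def)
    qed
    \<comment> \<open>Both excluded values of \<open>a \<bullet> v\<close> enter as divisors,
      \<open>m\<close> and \<open>1 + m\<close>. The slope is negative when \<open>m < -1\<close>,
      which \<open>lrelu\<close> permits.\<close>
    have kink: "(1 + m) * lrelu (1 / (1 + m)) s = s + m * relu s" for s
    proof (cases "s \<ge> 0")
      case True
      then show ?thesis by (simp add: lrelu_def relu_def distrib_right)
    next
      case False
      then show ?thesis using m0 by (simp add: lrelu_def relu_def)
    qed
    have "(\<Sum>i\<in>UNIV. lrelu (1 / (1 + m)) (q i \<bullet> z + b' i) *\<^sub>R p i)
        = lrelu (1 / (1 + m)) (a \<bullet> z + b) *\<^sub>R p j + (\<Sum>i\<in>UNIV - {j}. (y i + C) *\<^sub>R p i)"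
      by (subst sum.remove[of _ j]) (auto simp: q_def[of j] b'_def qy lin intro!: sum.cong)
    also have "lrelu (1 / (1 + m)) (a \<bullet> z + b) *\<^sub>R p j = ((a \<bullet> z + b) / m + relu (a \<bullet> z + b)) *\<^sub>R v"
      using kink[of "a \<bullet> z + b"] m0 by (simp add: p_def field_simps)
    also have "(\<Sum>i\<in>UNIV - {j}. (y i + C) *\<^sub>R p i)
        = (\<Sum>i\<in>UNIV - {j}. y i *\<^sub>R axis i 1) - ((\<Sum>i\<in>UNIV - {j}. y i * a $ i) / m) *\<^sub>R v + (\<Sum>i\<in>UNIV - {j}. C *\<^sub>R p i)"
    proof -
      have "(\<Sum>i\<in>UNIV - {j}. y i *\<^sub>R p i) = (\<Sum>i\<in>UNIV - {j}. y i *\<^sub>R axis i 1 - (y i * a $ i / m) *\<^sub>R v)"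
        by (intro sum.cong) (auto simp: p_def scaleR_diff_right)
      then show ?thesis
        by (simp add: scaleR_add_left sum.distrib sum_subtractf scaleR_sum_left sum_divide_distrib)
    qed
    finally have "(\<Sum>i\<in>UNIV. lrelu (1 / (1 + m)) (q i \<bullet> z + b' i) *\<^sub>R p i) + c
        = (\<Sum>i\<in>UNIV - {j}. y i *\<^sub>R axis i 1)
          + ((a \<bullet> z - (\<Sum>i\<in>UNIV - {j}. y i * a $ i)) / m) *\<^sub>R v + relu (a \<bullet> z + b) *\<^sub>R v"
      by (simp add: c_def algebra_simps add_divide_distrib diff_divide_distrib)
    also have "(a \<bullet> z - (\<Sum>i\<in>UNIV - {j}. y i * a $ i)) / m = t" using az m0 by simp
    finally show ?thesis using zy by simp
  qed
  then show ?thesis by (rule that)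
qed

text \<open>If \<open>a \<bullet> v\<close> is exceptional, \<open>a\<close> is moved slightly along
  \<open>v\<close>; all but two amounts \<open>\<eta>\<close> avoid the exceptional values. As
  \<open>relu\<close> is 1-Lipschitz, the shear changes by at most
  \<open>\<eta> * (norm v)\<^sup>2 * R'\<close> on the ball.\<close>

lemma shear_preserving_lrelu:
  fixes a v :: "real^'w" and K :: "(real^'n) set"
  assumes w: "CARD('w) \<le> w"
  shows "(\<lambda>z. z + relu (a \<bullet> z + b) *\<^sub>R v) \<in> approx_preserving (range lrelu) w K"
proof (cases "v = 0")
  case True
  then show ?thesis using map_monoid.ident[OF map_monoid_approx_preserving] by simp
next
  case False
  then obtain j where j: "v $ j \<noteq> 0" by (auto simp: vec_eq_iff)
  show ?thesis
  proof (rule layer_approx_preserving[OF continuous_on_shear[OF continuous_on_relu]])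
    fix R e :: real
    assume "e > 0"
    define R' where "R' = max R 1"
    have R': "R' > 0" "R \<le> R'" by (auto simp: R'_def)
    have v: "(norm v)\<^sup>2 > 0" using False by simp
    define \<eta>0 where "\<eta>0 = e / ((norm v)\<^sup>2 * R')"
    have "\<eta>0 > 0" using \<open>e > 0\<close> v R' by (simp add: \<eta>0_def)
    then have "infinite {0<..<\<eta>0}" by (simp add: infinite_Ioo)
    then have "\<not> {0<..<\<eta>0} \<subseteq> {- (a \<bullet> v) / (norm v)\<^sup>2, (- 1 - a \<bullet> v) / (norm v)\<^sup>2}"
      using finite_subset by blast
    then obtain \<eta> where \<eta>': "\<eta> \<in> {0<..<\<eta>0}"
      "\<eta> \<notin> {- (a \<bullet> v) / (norm v)\<^sup>2, (- 1 - a \<bullet> v) / (norm v)\<^sup>2}"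
      by blast
    have \<eta>: "0 < \<eta>" "\<eta> < \<eta>0" using \<eta>'(1) by auto
    define a' where "a' = a + \<eta> *\<^sub>R v"
    have av: "a' \<bullet> v = a \<bullet> v + \<eta> * (norm v)\<^sup>2"
      by (simp add: a'_def inner_add_left power2_norm_eq_inner)
    have "a' \<bullet> v \<noteq> r" if "\<eta> \<noteq> (r - a \<bullet> v) / (norm v)\<^sup>2" for r
    proof
      assume "a' \<bullet> v = r"
      then have "\<eta> * (norm v)\<^sup>2 = r - a \<bullet> v" unfolding av by simp
      with v have "\<eta> = (r - a \<bullet> v) / (norm v)\<^sup>2" by (intro eq_divide_imp) auto
      then show False using that by simp
    qed
    from this[of 0] this[of "-1"] have "a' \<bullet> v \<noteq> 0" "a' \<bullet> v \<noteq> -1" using \<eta>'(2) by auto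
    from lrelu_layer[OF this j, of R b] obtain \<beta> q b' p c where eq: "\<And>z. norm z \<le> R \<Longrightarrow>
      z + relu (a' \<bullet> z + b) *\<^sub>R v = (\<Sum>i\<in>(UNIV::'w set). lrelu \<beta> (q i \<bullet> z + b' i) *\<^sub>R p i) + c"
      by blast
    define \<Psi> where "\<Psi> z = (\<Sum>i\<in>(UNIV::'w set). lrelu \<beta> (q i \<bullet> z + b' i) *\<^sub>R p i) + c" for z
    have "(\<lambda>x. \<Psi> (g x)) \<in> NN (range lrelu) w" if "g \<in> NN (range lrelu) w" for g :: "real^'n \<Rightarrow> real^'w"
      unfolding \<Psi>_def by (rule NN_layer[OF that _ w]) simp
    moreover have "norm (z + relu (a \<bullet> z + b) *\<^sub>R v - \<Psi> z) \<le> e" if z: "norm z \<le> R" for z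
    proof -
      have "z + relu (a \<bullet> z + b) *\<^sub>R v - \<Psi> z = (relu (a \<bullet> z + b) - relu (a' \<bullet> z + b)) *\<^sub>R v"
        using eq[OF z] by (simp add: \<Psi>_def scaleR_left_diff_distrib flip: eq[OF z])
      then have "norm (z + relu (a \<bullet> z + b) *\<^sub>R v - \<Psi> z) \<le> \<bar>\<eta> * (v \<bullet> z)\<bar> * norm v"
        using relu_lipschitz[of "a \<bullet> z + b" "a' \<bullet> z + b"]
        by (simp add: a'_def inner_add_left mult_right_mono)
      also have "\<dots> \<le> (\<eta> * (norm v * R')) * norm v"
        using Cauchy_Schwarz_ineq2[of v z] z R' \<eta>(1)
        by (intro mult_right_mono) (auto simp: abs_mult intro!: mult_left_mono order_trans[OF Cauchy_Schwarz_ineq2])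
      also have "\<dots> = \<eta> * ((norm v)\<^sup>2 * R')" by (simp add: power2_eq_square)
      also have "\<dots> \<le> \<eta>0 * ((norm v)\<^sup>2 * R')" using \<eta>(2) v R' by (intro mult_right_mono) auto
      also have "\<dots> = e" using v R' by (simp add: \<eta>0_def)
      finally show ?thesis .
    qed
    ultimately show "\<exists>\<Psi>. (\<forall>g. g \<in> NN (range lrelu) w \<longrightarrow> (\<lambda>x::real^'n. \<Psi> (g x)) \<in> NN (range lrelu) w) \<and>
      (\<forall>z. norm z \<le> R \<longrightarrow> norm (z + relu (a \<bullet> z + b) *\<^sub>R v - \<Psi> z) \<le> e)"
      by (intro exI[of _ \<Psi>] conjI allI impI)
  qed
qed

section \<open>From shears to universal approximation\<close>

text \<open>The linear start \<open>G 0\<close> of the isotopy is a network without hidden layers. A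
  map in \<open>approx_preserving S w K\<close> carries it close to the end \<open>G 1\<close>, and
  the offset \<open>c\<close> goes into the output bias.\<close>

lemma compactly_approximates_of_shears:
  assumes dim: "2 * CARD('n) < CARD('w)"
    and shear: "\<And>K a b v. (\<lambda>z. z + \<sigma> (a \<bullet> z + b) *\<^sub>R v)
      \<in> (approx_preserving S w (K :: (real^'n) set) :: (real^'w \<Rightarrow> real^'w) set)"
    and cont: "continuous_on UNIV \<sigma>" and nonpoly: "\<not> (\<exists>p. \<forall>x. \<sigma> x = poly p x)"
  shows "compactly_approximates (NN S w :: (real^'n \<Rightarrow> real^'w) set)"
  unfolding compactly_approximates_def
proof (intro allI impI)
  fix f :: "real^'n \<Rightarrow> real^'w" and K :: "(real^'n) set" and \<epsilon> :: real
  assume f: "continuous_on UNIV f" and K: "compact K" and "\<epsilon> > 0"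
  \<comment> \<open>Three errors of \<open>\<epsilon> / 4\<close> leave a bound strictly below
    \<open>\<epsilon>\<close>.\<close>
  then have e4: "\<epsilon> / 4 > 0" by simp
  obtain R where R: "R > 0" "\<And>x. x \<in> K \<Longrightarrow> norm x \<le> R"
    using compact_imp_bounded[OF K] by (auto simp: bounded_pos)
  interpret map_monoid "approx_preserving S w K :: (real^'w \<Rightarrow> real^'w) set"
    by (rule map_monoid_approx_preserving)
  have dim': "2 * CARD('n) < DIM(real^'w)" using dim by simp
  obtain c :: "real^'w" and G u :: "real \<Rightarrow> real^'n \<Rightarrow> real^'w" and L where
    G: "\<And>x. norm x \<le> R \<Longrightarrow> norm (f x - (c + G 1 x)) \<le> \<epsilon> / 4" "linear (G 0)"
      "\<And>t x. ((\<lambda>t. G t x) has_vector_derivative u t x) (at t)"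
      "continuous_on UNIV (\<lambda>(t, x). u t x)" "L \<ge> 0"
      "\<And>t x y. 0 \<le> t \<Longrightarrow> t \<le> 1 \<Longrightarrow> norm x \<le> R \<Longrightarrow> norm y \<le> R \<Longrightarrow>
        norm (u t x - u t y) \<le> L * norm (G t x - G t y)"
    by (rule embedding_isotopy[OF dim' f e4 less_imp_le[OF R(1)]]) (rule that)
  have bdd: "bounded (G 0 ` cball 0 R)"
    by (rule bounded_linear_image[OF bounded_cball linear_conv_bounded_linear[THEN iffD1, OF G(2)]])
  have "\<exists>\<Phi>\<in>approx_preserving S w K. \<forall>x\<in>cball 0 R. norm (\<Phi> (G 0 x) - G 1 x) \<le> \<epsilon> / 4"
  proof (rule isotopy_endpoint[OF continuous_in_euler_fields[OF shear cont nonpoly] compact_cball bdd G(3) _ G(5) _ e4])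
    show "continuous_on ({0..1} \<times> cball 0 R) (\<lambda>(t, x). u t x)"
      using G(4) by (rule continuous_on_subset) simp
  qed (auto intro: G(6))
  then obtain \<Phi> where \<Phi>: "\<Phi> \<in> approx_preserving S w K" "\<And>x. norm x \<le> R \<Longrightarrow> norm (\<Phi> (G 0 x) - G 1 x) \<le> \<epsilon> / 4"
    by auto
  have "G 0 \<in> NN S w" using NN_affine[OF G(2), of 0] by simp
  then have "approx_on S w K (G 0)"
    unfolding approx_on_def using R(2)
    by (intro conjI bounded_subset[OF bdd] allI impI bexI[of _ "G 0"]) auto
  then have "approx_on S w K (\<lambda>x. \<Phi> (G 0 x))" using \<Phi>(1) by (simp add: approx_preserving_def)
  then obtain g where g: "g \<in> NN S w" "\<And>x. x \<in> K \<Longrightarrow> norm (\<Phi> (G 0 x) - g x) \<le> \<epsilon> / 4"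
    using approx_onE[OF _ e4] by blast
  have close: "infnorm (f x - (g x + c)) \<le> 3 / 4 * \<epsilon>" if x: "x \<in> K" for x
  proof -
    have "f x - (g x + c) = (f x - (c + G 1 x)) - (\<Phi> (G 0 x) - G 1 x) + (\<Phi> (G 0 x) - g x)" by simp
    also have "norm \<dots> \<le> \<epsilon> / 4 + \<epsilon> / 4 + \<epsilon> / 4"
      by (rule norm_triangle_le, rule add_mono[OF norm_triangle_le_diff g(2)[OF x]],
          rule add_mono[OF G(1) \<Phi>(2)], use R x in auto)
    finally show ?thesis using infnorm_le_norm[of "f x - (g x + c)"] by simp
  qed
  have mem: "(\<lambda>x. g x + c) \<in> NN S w" using NN_affine_image[OF g(1) linear_id, of c] by simp
  have "3 / 4 * \<epsilon> < \<epsilon>" using \<open>\<epsilon> > 0\<close> by simp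
  with close show "\<exists>g\<in>NN S w. \<exists>\<delta><\<epsilon>. \<forall>x\<in>K. infnorm (f x - g x) \<le> \<delta>"
    by (intro bexI[OF _ mem] exI conjI ballI)
qed

text \<open>The target is padded to the larger dimension and the network output is projected back
  linearly, which does not increase the max-norm.\<close>

lemma compactly_approximates_projection:
  assumes approx: "compactly_approximates (NN S w :: (real^'n \<Rightarrow> real^'w) set)"
    and card: "CARD('m) \<le> CARD('w)"
  shows "compactly_approximates (NN S w :: (real^'n \<Rightarrow> real^'m) set)"
  unfolding compactly_approximates_def
proof (intro allI impI)
  fix f :: "real^'n \<Rightarrow> real^'m" and K :: "(real^'n) set" and \<epsilon> :: real
  assume f: "continuous_on UNIV f" and K: "compact K" and "\<epsilon> > 0"
  obtain \<iota> :: "'m \<Rightarrow> 'w" where \<iota>: "inj \<iota>"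
    using inj_on_iff_card_le[of "UNIV :: 'm set" "UNIV :: 'w set"] card by auto
  \<comment> \<open>Outside the range of \<open>\<iota>\<close>, \<open>inv \<iota>\<close> takes
    arbitrary values; those coordinates repeat coordinates of \<open>f\<close> and are dropped by
    \<open>P\<close>.\<close>
  define f' where "f' x = (\<chi> i. f x $ inv \<iota> i)" for x
  have "continuous_on UNIV f'" unfolding f'_def by (intro continuous_intros f)
  then have "\<exists>g\<in>NN S w. \<exists>\<delta><\<epsilon>. \<forall>x\<in>K. infnorm (f' x - (g x :: real^'w)) \<le> \<delta>"
    using approx K \<open>\<epsilon> > 0\<close> unfolding compactly_approximates_def by simp
  then obtain g :: "real^'n \<Rightarrow> real^'w" and \<delta> where
    g: "g \<in> NN S w" "\<delta> < \<epsilon>" "\<forall>x\<in>K. infnorm (f' x - g x) \<le> \<delta>"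
    by (elim bexE exE conjE)
  define P where "P y = (\<chi> k. y $ \<iota> k)" for y :: "real^'w"
  have "linear P" unfolding P_def by (rule linearI) (simp_all add: vec_eq_iff)
  from NN_affine_image[OF g(1) this, of 0] have mem: "(\<lambda>x. P (g x)) \<in> NN S w" by simp
  have "infnorm (f x - P (g x)) \<le> \<delta>" if "x \<in> K" for x
  proof -
    have "\<bar>(f x - P (g x)) $ k\<bar> \<le> infnorm (f' x - g x)" for k
      using component_le_infnorm_cart[of "f' x - g x" "\<iota> k"] \<iota> by (simp add: P_def f'_def)
    then have "infnorm (f x - P (g x)) \<le> infnorm (f' x - g x)"
      unfolding infnorm_cart[of "f x - P (g x)"] by (intro cSup_least) auto
    then show ?thesis using g(3) that by force
  qed
  with g(2) show "\<exists>g\<in>NN S w. \<exists>\<delta><\<epsilon>. \<forall>x\<in>K. infnorm (f x - g x) \<le> \<delta>"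
    by (intro bexI[OF _ mem] exI conjI ballI)
qed

lemma compactly_approximates_lrelu:
  assumes "2 * CARD('n) < CARD('w)" "CARD('w) \<le> w"
  shows "compactly_approximates (NN (range lrelu) w :: (real^'n \<Rightarrow> real^'w) set)"
  by (rule compactly_approximates_of_shears[OF assms(1) shear_preserving_lrelu[OF assms(2)]
        continuous_on_relu relu_not_poly])

lemma compactly_approximates_smooth_point:
  assumes "2 * CARD('n) < CARD('w)" "CARD('w) + 1 \<le> w" "continuous_on UNIV \<sigma>"
    "\<not> (\<exists>p. \<forall>x. \<sigma> x = poly p x)" "(\<sigma> has_real_derivative D) (at \<alpha>)" "D \<noteq> 0"
  shows "compactly_approximates (NN {\<sigma>} w :: (real^'n \<Rightarrow> real^'w) set)"
  by (rule compactly_approximates_of_shears[OF assms(1)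
        shear_preserving_smooth_point[OF assms(3,5,6,2)] assms(3,4)])

lemma relu_has_derivative: "(relu has_real_derivative 1) (at 1)"
proof (rule has_field_derivative_transform_within_open[of "\<lambda>x. x" _ _ "{0<..}"])
  show "((\<lambda>x. x) has_real_derivative 1) (at 1)" by (rule DERIV_ident)
qed (auto simp: relu_def)

lemma NN_lrelu_universal:
  "compactly_approximates (NN (range lrelu) (max (2 * CARD('n) + 1) CARD('m)) :: (real ^ 'n \<Rightarrow> real ^ 'm) set)"
proof (cases "2 * CARD('n) < CARD('m)")
  case True
  then show ?thesis by (intro compactly_approximates_lrelu) auto
next
  case False
  then have "compactly_approximates (NN (range lrelu) (max (2 * CARD('n) + 1) CARD('m))
      :: (real^'n \<Rightarrow> real^(('n + 'n) option)) set)"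
    by (intro compactly_approximates_lrelu) auto
  then show ?thesis by (rule compactly_approximates_projection) (use False in auto)
qed

text \<open>The strict inequality for \<open>w\<close> provides the one extra neuron; it holds for
  the widths of both the ReLU case and the general case.\<close>

lemma NN_smooth_point_universal:
  assumes "continuous_on UNIV \<sigma>" "\<not> (\<exists>p. \<forall>x. \<sigma> x = poly p x)"
    and "(\<sigma> has_real_derivative D) (at \<alpha>)" "D \<noteq> 0" and w: "max (2 * CARD('n) + 1) CARD('m) < w"
  shows "compactly_approximates (NN {\<sigma>} w :: (real ^ 'n \<Rightarrow> real ^ 'm) set)"
proof (cases "2 * CARD('n) < CARD('m)")
  case True
  then show ?thesis using w by (intro compactly_approximates_smooth_point[OF _ _ assms(1-4)]) auto
next
  case False
  then have "compactly_approximates (NN {\<sigma>} w :: (real^'n \<Rightarrow> real^(('n + 'n) option)) set)"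
    using w by (intro compactly_approximates_smooth_point[OF _ _ assms(1-4)]) auto
  then show ?thesis by (rule compactly_approximates_projection) (use False in auto)
qed

theorem theorem1:
  shows "compactly_approximates
           (NN (range lrelu) (max (2 * CARD('n) + 1) CARD('m)) :: (real ^ 'n \<Rightarrow> real ^ 'm) set)
       \<and> compactly_approximates
           (NN {relu} (max (2 * CARD('n) + 1) CARD('m) + 1) :: (real ^ 'n \<Rightarrow> real ^ 'm) set)
       \<and> (\<forall>(\<sigma>::real \<Rightarrow> real) a. continuous_on UNIV \<sigma> \<longrightarrow> \<not> (\<exists>p :: real poly. \<forall>x. \<sigma> x = poly p x) \<longrightarrow>
          (\<exists>e>0. \<sigma> C1_differentiable_on ball a e) \<longrightarrow> deriv \<sigma> a \<noteq> 0 \<longrightarrow>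
          compactly_approximates
           (NN {\<sigma>} (max (2 * CARD('n) + 1) CARD('m) + 2) :: (real ^ 'n \<Rightarrow> real ^ 'm) set))"
proof (intro conjI allI impI)
  show "compactly_approximates
      (NN (range lrelu) (max (2 * CARD('n) + 1) CARD('m)) :: (real ^ 'n \<Rightarrow> real ^ 'm) set)"
    by (rule NN_lrelu_universal)
  show "compactly_approximates
      (NN {relu} (max (2 * CARD('n) + 1) CARD('m) + 1) :: (real ^ 'n \<Rightarrow> real ^ 'm) set)"
    by (rule NN_smooth_point_universal[OF continuous_on_relu relu_not_poly relu_has_derivative]) (simp, arith)
  fix \<sigma> :: "real \<Rightarrow> real" and a
  assume \<sigma>: "continuous_on UNIV \<sigma>" "\<not> (\<exists>p :: real poly. \<forall>x. \<sigma> x = poly p x)"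
    and C1: "\<exists>e>0. \<sigma> C1_differentiable_on ball a e" and D: "deriv \<sigma> a \<noteq> 0"
  from C1 obtain D' where "(\<sigma> has_vector_derivative D') (at a)"
    unfolding C1_differentiable_on_def by (metis centre_in_ball)
  then have "(\<sigma> has_real_derivative deriv \<sigma> a) (at a)"
    using DERIV_imp_deriv has_real_derivative_iff_has_vector_derivative by metis
  then show "compactly_approximates
      (NN {\<sigma>} (max (2 * CARD('n) + 1) CARD('m) + 2) :: (real ^ 'n \<Rightarrow> real ^ 'm) set)"
    by (rule NN_smooth_point_universal[OF \<sigma> _ D]) arith
qed

end
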